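(* Let $\lambda>0$ be fixed, and for positive integers $n$ with $k=\lambda n\in\mathbb N$ let $(Y_1,\dots,Y_n)$ be multinomial with parameters $(k,\frac1n,\dots,\frac1n)$, with order statistics $Y_{(1)}\le\dots\le Y_{(n)}$. Let $m_n,p_n,z_n$ be the sequences defined in the context, for $F$ the distribution function of a Poisson random variable with parameter $\lambda$. Then, as $n\to+\infty$ (with $\lambda=k/n$ fixed): (1) for every fixed integer $t\ge0$, $$\mathbb P(\text{at least $t$ ties at }Y_{(n)})\sim p_n+1-p_n\sum_{j=0}^{t}\frac{\ln^j\left(\frac1{p_n}\right)}{j!};$$ (2) for every fixed $c>0$: if $c<1$, then $\mathbb P\left(Y_{(n-cz_n)}>m_n-1\right)\to1$; if $c>1$, then $\mathbb P\left(Y_{(n-cz_n)}>m_n-1\right)\to0$.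
   Context: $a_n\sim b_n$ means $a_n/b_n\to1$. "At least $t$ ties at $Y_{(n)}$" means $Y_{(n-t)}=Y_{(n)}$, i.e. at least $t+1$ of the $Y_i$ are equal to the maximum (a unique maximizer corresponds to zero ties). The index $n-cz_n$ is understood as $n-\lfloor cz_n\rfloor$. Definition of $m_n,p_n,z_n$ for a distribution function $F$ of an integer-valued random variable with support unbounded above. Let $\mathcal F=1-F$ and let $\gamma=\lim_{n\to\infty}\mathcal F(n+1)/\mathcal F(n)$ (for the Poisson distribution $\gamma=0$). Let $\mathcal G:\mathbb R\to\mathbb R$ be a continuous, decreasing (not necessarily strictly) function with $\mathcal G(j)=\mathcal F(j)$ for all $j\in\mathbb Z$ and $\lim_{x\to+\infty}\mathcal G(x+\epsilon)/\mathcal G(x)=\gamma^{\epsilon}$ for every $\epsilon\in(0,1)$; for example, $\mathcal G$ may be the log-linear interpolation of $\mathcal F$ (that is, $\ln\mathcal G$ is affine on each interval $[j,j+1]$, $j\in\mathbb Z$). For $n\ge2$ let $x_n$ be a solution of $\mathcal G(x_n)=\frac1n$, and set $$m_n=\left\lfloor x_n+\tfrac12\right\rfloor,\qquad \theta_n=\frac{\mathcal G(m_n)}{\mathcal G(x_n)}=n\,\mathcal F(m_n),\qquad p_n=e^{-\theta_n},\qquad z_n=\frac{\mathcal G(m_n-1)}{\mathcal G(x_n)}=n\,\mathcal F(m_n-1).$$ *)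

theory Defs
  imports "HOL-Probability.Probability"
begin

text \<open>The random variables \<open>Y i\<close>, \<open>i \<in> I\<close>, on \<open>M\<close> are jointly multinomial with \<open>k\<close> trials and
  cell probabilities \<open>p i\<close>.\<close>

definition multinomial ::
  "'a measure \<Rightarrow> 'i set \<Rightarrow> nat \<Rightarrow> ('i \<Rightarrow> real) \<Rightarrow> ('i \<Rightarrow> 'a \<Rightarrow> nat) \<Rightarrow> bool"
  where "multinomial M I k p Y \<longleftrightarrow>
    prob_space M \<and>
    (\<forall>i\<in>I. Y i \<in> measurable M (count_space UNIV)) \<and>
    (\<forall>y. measure M {\<omega> \<in> space M. \<forall>i\<in>I. Y i \<omega> = y i} =
      (if (\<Sum>i\<in>I. y i) = k
       then fact k / (\<Prod>i\<in>I. fact (y i)) * (\<Prod>i\<in>I. p i ^ y i) else 0))"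

text \<open>The \<open>i\<close>-th smallest of \<open>y 1, \<dots>, y n\<close>; meaningful only for \<open>1 \<le> i \<le> n\<close>.\<close>

definition order_stat :: "nat \<Rightarrow> (nat \<Rightarrow> 'a::linorder) \<Rightarrow> nat \<Rightarrow> 'a"
  where "order_stat n y i = sort (map y [1..<Suc n]) ! (i - 1)"

definition at_least_ties :: "nat \<Rightarrow> (nat \<Rightarrow> 'a::linorder) \<Rightarrow> nat \<Rightarrow> bool"
  where "at_least_ties n y t \<longleftrightarrow> order_stat n y (n - t) = order_stat n y n"

definition poisson_cdf :: "real \<Rightarrow> real \<Rightarrow> real"
  where "poisson_cdf l = cdf (distr (measure_pmf (poisson_pmf l)) borel real)"

definition tail_ratio :: "(real \<Rightarrow> real) \<Rightarrow> real"
  where "tail_ratio F = lim (\<lambda>n. (1 - F (real n + 1)) / (1 - F (real n)))"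

text \<open>\<open>G\<close> is an admissible continuous extension of the tail \<open>1 - F\<close> from the integers. When
  \<open>tail_ratio F = 0\<close>, the limit below is \<open>0 powr \<epsilon> = 0\<close>.\<close>

definition tail_extension :: "(real \<Rightarrow> real) \<Rightarrow> (real \<Rightarrow> real) \<Rightarrow> bool"
  where "tail_extension F G \<longleftrightarrow>
    continuous_on UNIV G \<and> antimono G \<and>
    (\<forall>j::int. G (of_int j) = 1 - F (of_int j)) \<and>
    (\<forall>\<epsilon>. 0 < \<epsilon> \<and> \<epsilon> < 1 \<longrightarrow>
      ((\<lambda>x. G (x + \<epsilon>) / G x) \<longlongrightarrow> tail_ratio F powr \<epsilon>) at_top)"

text \<open>In the following, \<open>x\<close> is the sequence of chosen solutions of \<open>G (x n) = 1 / n\<close>.\<close>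

definition m_seq :: "(nat \<Rightarrow> real) \<Rightarrow> nat \<Rightarrow> int"
  where "m_seq x n = \<lfloor>x n + 1 / 2\<rfloor>"

definition theta_seq :: "(real \<Rightarrow> real) \<Rightarrow> (nat \<Rightarrow> real) \<Rightarrow> nat \<Rightarrow> real"
  where "theta_seq G x n = G (of_int (m_seq x n)) / G (x n)"

definition p_seq :: "(real \<Rightarrow> real) \<Rightarrow> (nat \<Rightarrow> real) \<Rightarrow> nat \<Rightarrow> real"
  where "p_seq G x n = exp (- theta_seq G x n)"

definition z_seq :: "(real \<Rightarrow> real) \<Rightarrow> (nat \<Rightarrow> real) \<Rightarrow> nat \<Rightarrow> real"
  where "z_seq G x n = G (of_int (m_seq x n - 1)) / G (x n)"

text \<open>\<open>n \<rightarrow> \<infinity>\<close> along the positive integers \<open>n\<close> with \<open>\<lambda> n \<in> \<nat>\<close>; the trivial filter if there are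
  none.\<close>

definition admissible_at_top :: "real \<Rightarrow> nat filter"
  where "admissible_at_top l = inf sequentially (principal {n. n > 0 \<and> l * real n \<in> \<nat>})"

end

theory Submission
  imports Defs
begin

text \<open>
  Let \<open>N a\<close> be the number of \<open>i\<close> with \<open>Y i = a\<close>. Its binomial moments are \<open>n choose r\<close> times the
  probability that \<open>r\<close> given cells have content \<open>a\<close>; they are asymptotic to \<open>\<mu> ^ r / r!\<close>, where
  \<open>\<mu>\<close> is \<open>n\<close> times the Poisson weight of \<open>a\<close>, as long as \<open>a\<^sup>2 / n\<close> tends to \<open>0\<close>. By inclusion-exclusion
  the law of \<open>N a\<close> is therefore close to the Poisson law of mean \<open>\<mu>\<close>, uniformly in \<open>\<mu>\<close>, and by
  Chebyshev's inequality \<open>N a / \<mu>\<close> tends to \<open>1\<close> in probability if \<open>\<mu>\<close> tends to infinity.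

  Since the Poisson tail decays faster than geometrically, only two values matter near the maximum:
  no \<open>Y i\<close> exceeds \<open>m + 1\<close>, the number of those equal to \<open>m\<close> is asymptotic to \<open>z\<close>, which
  tends to infinity, and the number of those equal to \<open>m + 1\<close> is nearly Poisson of mean \<open>\<theta>\<close>, which may
  oscillate between \<open>0\<close> and infinity. So there are at least \<open>t\<close> ties iff \<open>N (m + 1)\<close> is \<open>0\<close> or at
  least \<open>t + 1\<close>. The resulting Poisson probability is bounded away from \<open>0\<close>, uniformly in \<open>\<theta>\<close>,
  so an additive error suffices.
\<close>

section \<open>Binomial moments and Poisson limits\<close>

text \<open>\<open>fact r\<close> times this is the \<open>r\<close>-th factorial moment of
  \<open>N\<close>.\<close>

definition binomial_moment :: "'a measure \<Rightarrow> ('a \<Rightarrow> nat) \<Rightarrow> nat \<Rightarrow> real"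
  where "binomial_moment M N r = (\<integral>\<omega>. real (N \<omega> choose r) \<partial>M)"

text \<open>Boundedness makes every real function of \<open>N\<close> integrable and the
  inclusion-exclusion series finite.\<close>

definition bounded_count :: "'a measure \<Rightarrow> ('a \<Rightarrow> nat) \<Rightarrow> bool"
  where "bounded_count M N \<longleftrightarrow> prob_space M \<and> N \<in> measurable M (count_space UNIV) \<and>
    (\<exists>b. \<forall>\<omega>\<in>space M. N \<omega> \<le> b)"

lemma bounded_count_measurable:
  "bounded_count M N \<Longrightarrow> N \<in> measurable M (count_space UNIV)"
  by (simp add: bounded_count_def)

lemma bounded_count_integrable:
  fixes f :: "nat \<Rightarrow> real"
  assumes "bounded_count M N"
  shows "integrable M (\<lambda>\<omega>. f (N \<omega>))"
proof -
  obtain b where b: "\<And>\<omega>. \<omega> \<in> space M \<Longrightarrow> N \<omega> \<le> b"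
    using assms by (auto simp: bounded_count_def)
  have [measurable]: "N \<in> measurable M (count_space UNIV)"
    using assms by (auto simp: bounded_count_def)
  interpret prob_space M using assms by (auto simp: bounded_count_def)
  show ?thesis
  proof (rule integrable_const_bound)
    show "AE \<omega> in M. norm (f (N \<omega>)) \<le> (\<Sum>i\<le>b. \<bar>f i\<bar>)"
      using b by (intro AE_I2) (auto intro!: member_le_sum)
  qed measurable
qed

text \<open>The product of the two binomial coefficients equals
  \<open>(N choose j) * (N - j choose s)\<close>. What remains is the alternating sum of a full row
  of Pascal's triangle, which vanishes unless \<open>N = j\<close>.\<close>

lemma alternating_choose_mult_sum:
  assumes "N \<le> b"
  shows "(\<Sum>s\<le>b. (-1) ^ s * real (j + s choose j) * real (N choose (j + s))) = of_bool (N = j)"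
proof (cases "j \<le> N")
  case False
  then show ?thesis by (intro trans[OF sum.neutral]) (auto simp: binomial_eq_0)
next
  case True
  have *: "real (j + s choose j) * real (N choose (j + s)) = real (N choose j) * real (N - j choose s)" for s
  proof (cases "j + s \<le> N")
    case True
    then show ?thesis using choose_mult[of j "j + s" N]
      by (simp flip: of_nat_mult add: mult.commute)
  qed (auto simp: binomial_eq_0)
  have "(\<Sum>s\<le>b. (-1) ^ s * real (j + s choose j) * real (N choose (j + s)))
      = real (N choose j) * (\<Sum>s\<le>b. (-1) ^ s * real (N - j choose s))"
    unfolding sum_distrib_left by (intro sum.cong refl) (simp add: * mult.assoc mult.left_commute)
  also have "(\<Sum>s\<le>b. (-1) ^ s * real (N - j choose s)) = (\<Sum>s\<le>N-j. (-1) ^ s * real (N - j choose s))"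
    using assms by (intro sum.mono_neutral_right) (auto simp: binomial_eq_0)
  also have "\<dots> = of_bool (N = j)"
    using choose_alternating_sum[of "N - j", where 'a = real] True by (cases "N = j") auto
  finally show ?thesis by auto
qed

text \<open>Inclusion-exclusion, by integrating the pointwise identity for the indicator of
  \<open>N = j\<close>. The sum is really finite, but the bound \<open>b\<close> may vary with
  \<open>M\<close> and \<open>N\<close>; an infinite series lets limits be taken termwise.\<close>

lemma prob_eq_sums_binomial_moment:
  assumes "bounded_count M N"
  shows "(\<lambda>s. (-1) ^ s * real (j + s choose j) * binomial_moment M N (j + s)) sums
    measure M {\<omega> \<in> space M. N \<omega> = j}"
proof -
  interpret prob_space M using assms by (auto simp: bounded_count_def)
  have [measurable]: "N \<in> measurable M (count_space UNIV)"
    using assms by (auto simp: bounded_count_def)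
  obtain b where b: "\<And>\<omega>. \<omega> \<in> space M \<Longrightarrow> N \<omega> \<le> b"
    using assms by (auto simp: bounded_count_def)
  have int: "integrable M (\<lambda>\<omega>. real (N \<omega> choose r))" for r
    using bounded_count_integrable[OF assms, of "\<lambda>n. real (n choose r)"] .
  have zero: "binomial_moment M N (j + s) = 0" if "s \<notin> {..b}" for s
  proof -
    have "binomial_moment M N (j + s) = (\<integral>\<omega>. 0 \<partial>M)"
      unfolding binomial_moment_def
    proof (rule Bochner_Integration.integral_cong)
      fix \<omega> assume "\<omega> \<in> space M"
      then show "real (N \<omega> choose (j + s)) = 0"
        using b[of \<omega>] that by (auto intro!: binomial_eq_0)
    qed auto
    then show ?thesis by simp
  qed
  have "measure M {\<omega> \<in> space M. N \<omega> = j} = (\<integral>\<omega>. indicator {\<omega> \<in> space M. N \<omega> = j} \<omega> \<partial>M)"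
    by simp
  also have "\<dots> = (\<integral>\<omega>. (\<Sum>s\<le>b. (-1) ^ s * real (j + s choose j) * real (N \<omega> choose (j + s))) \<partial>M)"
    by (intro Bochner_Integration.integral_cong)
       (auto simp: alternating_choose_mult_sum[OF b] indicator_def)
  also have "\<dots> = (\<Sum>s\<le>b. (-1) ^ s * real (j + s choose j) * binomial_moment M N (j + s))"
    unfolding binomial_moment_def
    by (subst Bochner_Integration.integral_sum) (auto intro!: int)
  finally show ?thesis
    using sums_finite[of "{..b}" "\<lambda>s. (-1) ^ s * real (j + s choose j) * binomial_moment M N (j + s)"] zero
    by auto
qed

text \<open>The same inclusion-exclusion series, now with the binomial moments
  \<open>\<theta> ^ r / fact r\<close> of the Poisson law, so that the two series can be subtracted
  term by term. It is the exponential series of \<open>- \<theta>\<close> times a constant.\<close>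

lemma poisson_weight_sums:
  fixes \<theta> :: real
  shows "(\<lambda>s. (-1) ^ s * real (j + s choose j) * (\<theta> ^ (j + s) / fact (j + s))) sums
    (exp (- \<theta>) * \<theta> ^ j / fact j)"
proof -
  have "(\<lambda>s. (-\<theta>) ^ s /\<^sub>R fact s * (\<theta> ^ j / fact j)) sums (exp (-\<theta>) * (\<theta> ^ j / fact j))"
    by (intro sums_mult2 exp_converges)
  moreover have "(-\<theta>) ^ s /\<^sub>R fact s * (\<theta> ^ j / fact j)
      = (-1) ^ s * real (j + s choose j) * (\<theta> ^ (j + s) / fact (j + s))" for s
    by (simp add: binomial_fact[of j "j + s"] field_simps power_add power_minus[of \<theta>])
  ultimately show ?thesis by simp
qed

text \<open>Chebyshev's inequality around \<open>\<theta>\<close>, which need not be the exact mean.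
  The second moment is rewritten by \<open>N * (N - 1) = 2 * (N choose 2)\<close>, and the bound is
  grouped into the ratios whose limits are known.\<close>

lemma deviation_prob_bound:
  assumes N: "bounded_count M N" and \<theta>: "\<theta> > 0" and \<epsilon>: "\<epsilon> > 0"
  shows "measure M {\<omega> \<in> space M. \<bar>real (N \<omega>) - \<theta>\<bar> \<ge> \<epsilon> * \<theta>} \<le>
    (2 * binomial_moment M N 2 / \<theta> ^ 2 + binomial_moment M N 1 / \<theta> * (1 / \<theta>)
      - 2 * (binomial_moment M N 1 / \<theta>) + 1) / \<epsilon> ^ 2"
proof -
  interpret prob_space M using N by (auto simp: bounded_count_def)
  have int: "integrable M (\<lambda>\<omega>. f (N \<omega>))" for f :: "nat \<Rightarrow> real"
    by (rule bounded_count_integrable[OF N])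
  have "measure M {\<omega> \<in> space M. (real (N \<omega>) - \<theta>)\<^sup>2 \<ge> (\<epsilon> * \<theta>)\<^sup>2}
      \<le> (\<integral>\<omega>. (real (N \<omega>) - \<theta>)\<^sup>2 \<partial>M) / (\<epsilon> * \<theta>)\<^sup>2"
    using \<theta> \<epsilon> int[of "\<lambda>n. (real n - \<theta>)\<^sup>2"]
    by (intro integral_Markov_inequality_measure[where A = "{}"]) auto
  also have "{\<omega> \<in> space M. (real (N \<omega>) - \<theta>)\<^sup>2 \<ge> (\<epsilon> * \<theta>)\<^sup>2} =
      {\<omega> \<in> space M. \<bar>real (N \<omega>) - \<theta>\<bar> \<ge> \<epsilon> * \<theta>}"
    using \<theta> \<epsilon> by (auto simp flip: abs_le_square_iff)
  also have "(\<integral>\<omega>. (real (N \<omega>) - \<theta>)\<^sup>2 \<partial>M) =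
      (\<integral>\<omega>. 2 * real (N \<omega> choose 2) + (1 - 2 * \<theta>) * real (N \<omega> choose 1) + \<theta>\<^sup>2 \<partial>M)"
  proof (rule Bochner_Integration.integral_cong)
    fix \<omega>
    have "2 * real (N \<omega> choose 2) = real (N \<omega>) * (real (N \<omega>) - 1)"
      by (cases "N \<omega>") (simp_all add: choose_two real_of_nat_div field_simps)
    then show "(real (N \<omega>) - \<theta>)\<^sup>2 =
        2 * real (N \<omega> choose 2) + (1 - 2 * \<theta>) * real (N \<omega> choose 1) + \<theta>\<^sup>2"
      by (simp add: power2_eq_square algebra_simps)
  qed simp
  also have "\<dots> = 2 * binomial_moment M N 2 + (1 - 2 * \<theta>) * binomial_moment M N 1 + \<theta>\<^sup>2"
    unfolding binomial_moment_def
    using int[of "\<lambda>n. real (n choose 2)"] int[of "\<lambda>n. real (n choose 1)"]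
    by (simp add: prob_space)
  also have "\<dots> / (\<epsilon> * \<theta>)\<^sup>2 = (2 * binomial_moment M N 2 / \<theta> ^ 2
      + binomial_moment M N 1 / \<theta> * (1 / \<theta>) - 2 * (binomial_moment M N 1 / \<theta>) + 1) / \<epsilon> ^ 2"
    using \<theta> \<epsilon> by (simp add: field_simps power2_eq_square)
  finally show ?thesis .
qed

text \<open>The Chebyshev bound tends to
  \<open>(1 + 0 - 2 + 1) / \<epsilon> ^ 2 = 0\<close>.\<close>

lemma deviation_prob_tendsto_0:
  assumes N: "\<forall>\<^sub>F n in F. bounded_count (M n) (N n)"
    and \<theta>: "filterlim \<theta> at_top F"
    and S1: "((\<lambda>n. binomial_moment (M n) (N n) 1 / \<theta> n) \<longlongrightarrow> 1) F"
    and S2: "((\<lambda>n. 2 * binomial_moment (M n) (N n) 2 / \<theta> n ^ 2) \<longlongrightarrow> 1) F"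
    and \<epsilon>: "\<epsilon> > 0"
  shows "((\<lambda>n. measure (M n) {\<omega> \<in> space (M n). \<bar>real (N n \<omega>) - \<theta> n\<bar> \<ge> \<epsilon> * \<theta> n}) \<longlongrightarrow> 0) F"
proof (rule tendsto_sandwich[OF _ _ tendsto_const])
  have "((\<lambda>n. 1 / \<theta> n) \<longlongrightarrow> 0) F"
    using tendsto_inverse_0_at_top[OF \<theta>] by (simp add: inverse_eq_divide)
  then have "((\<lambda>n. (2 * binomial_moment (M n) (N n) 2 / \<theta> n ^ 2
      + binomial_moment (M n) (N n) 1 / \<theta> n * (1 / \<theta> n)
      - 2 * (binomial_moment (M n) (N n) 1 / \<theta> n) + 1) / \<epsilon> ^ 2) \<longlongrightarrow> (1 + 1 * 0 - 2 * 1 + 1) / \<epsilon> ^ 2) F"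
    using \<epsilon> by (intro tendsto_intros S1 S2) auto
  then show "((\<lambda>n. (2 * binomial_moment (M n) (N n) 2 / \<theta> n ^ 2
      + binomial_moment (M n) (N n) 1 / \<theta> n * (1 / \<theta> n)
      - 2 * (binomial_moment (M n) (N n) 1 / \<theta> n) + 1) / \<epsilon> ^ 2) \<longlongrightarrow> 0) F"
    by simp
  have "\<forall>\<^sub>F n in F. \<theta> n > 0"
    using \<theta> by (auto simp: filterlim_at_top_dense)
  with N show "\<forall>\<^sub>F n in F. measure (M n) {\<omega> \<in> space (M n). \<bar>real (N n \<omega>) - \<theta> n\<bar> \<ge> \<epsilon> * \<theta> n} \<le>
    (2 * binomial_moment (M n) (N n) 2 / \<theta> n ^ 2
      + binomial_moment (M n) (N n) 1 / \<theta> n * (1 / \<theta> n)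
      - 2 * (binomial_moment (M n) (N n) 1 / \<theta> n) + 1) / \<epsilon> ^ 2"
    by eventually_elim (use \<epsilon> deviation_prob_bound in blast)
qed auto

text \<open>Tannery's theorem applied to the difference of the two inclusion-exclusion series: each
  term tends to \<open>0\<close>, and the bound on all binomial moments supplies a summable
  majorant.\<close>

lemma poisson_limit_bounded_mean:
  assumes F: "F \<noteq> bot"
    and N: "\<forall>\<^sub>F n in F. bounded_count (M n) (N n)"
    and \<theta>: "\<forall>\<^sub>F n in F. 0 < \<theta> n \<and> \<theta> n \<le> \<Theta>"
    and S: "\<And>r. ((\<lambda>n. fact r * binomial_moment (M n) (N n) r / \<theta> n ^ r) \<longlongrightarrow> 1) F"
    and bound: "\<forall>\<^sub>F n in F. \<forall>r. binomial_moment (M n) (N n) r \<le> (C * \<theta> n) ^ r / fact r"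
  shows "((\<lambda>n. measure (M n) {\<omega> \<in> space (M n). N n \<omega> = j} -
           exp (- \<theta> n) * \<theta> n ^ j / fact j) \<longlongrightarrow> 0) F"
proof -
  define d where "d = (\<lambda>s n. (-1) ^ s * real (j + s choose j) *
    (binomial_moment (M n) (N n) (j + s) - \<theta> n ^ (j + s) / fact (j + s)))"
  \<comment> \<open>\<open>K\<close> bounds both \<open>\<theta> n\<close> and
    \<open>\<bar>C * \<theta> n\<bar>\<close>. In the majorant below, \<open>2 ^ (j + s)\<close>
    estimates the binomial coefficient and the last factor \<open>2\<close> covers the two terms of
    the difference.\<close>
  define K where "K = max 1 (\<bar>C\<bar> * \<Theta>) + \<Theta>"
  have "((\<lambda>n. d s n) \<longlongrightarrow> 0) F" for s
  proof (rule Lim_null_comparison)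
    let ?r = "j + s"
    have "((\<lambda>n. real (?r choose j) * (\<Theta> ^ ?r / fact ?r) *
        \<bar>fact ?r * binomial_moment (M n) (N n) ?r / \<theta> n ^ ?r - 1\<bar>) \<longlongrightarrow>
        real (?r choose j) * (\<Theta> ^ ?r / fact ?r) * \<bar>1 - 1\<bar>) F"
      by (intro tendsto_intros S)
    then show "((\<lambda>n. real (?r choose j) * (\<Theta> ^ ?r / fact ?r) *
        \<bar>fact ?r * binomial_moment (M n) (N n) ?r / \<theta> n ^ ?r - 1\<bar>) \<longlongrightarrow> 0) F"
      by simp
    show "\<forall>\<^sub>F n in F. norm (d s n) \<le> real (?r choose j) * (\<Theta> ^ ?r / fact ?r) *
        \<bar>fact ?r * binomial_moment (M n) (N n) ?r / \<theta> n ^ ?r - 1\<bar>"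
      using \<theta>
    proof eventually_elim
      case (elim n)
      \<comment> \<open>The moment hypothesis controls a relative error; boundedness of
        \<open>\<theta>\<close> turns it into an absolute one.\<close>
      have "binomial_moment (M n) (N n) ?r - \<theta> n ^ ?r / fact ?r =
          \<theta> n ^ ?r / fact ?r * (fact ?r * binomial_moment (M n) (N n) ?r / \<theta> n ^ ?r - 1)"
        using elim by (simp add: field_simps)
      then have "norm (d s n) = real (?r choose j) * (\<theta> n ^ ?r / fact ?r *
          \<bar>fact ?r * binomial_moment (M n) (N n) ?r / \<theta> n ^ ?r - 1\<bar>)"
        using elim by (simp add: d_def abs_mult power_abs)
      also have "\<dots> \<le> real (?r choose j) * (\<Theta> ^ ?r / fact ?r *
          \<bar>fact ?r * binomial_moment (M n) (N n) ?r / \<theta> n ^ ?r - 1\<bar>)"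
        using elim by (intro mult_left_mono mult_right_mono divide_right_mono power_mono) auto
      finally show ?case by (simp add: mult.assoc)
    qed
  qed
  moreover have "\<forall>\<^sub>F (s, n) in at_top \<times>\<^sub>F F. norm (d s n) \<le> (2 * K) ^ (j + s) / fact (j + s) * 2"
  proof -
    have "\<forall>\<^sub>F n in F. \<forall>s. norm (d s n) \<le> (2 * K) ^ (j + s) / fact (j + s) * 2"
      using \<theta> bound
    proof eventually_elim
      case (elim n)
      show ?case
      proof
        fix s
        let ?r = "j + s"
        have K: "0 \<le> \<theta> n" "\<theta> n \<le> K" "\<bar>C * \<theta> n\<bar> \<le> K"
        proof -
          have "\<bar>C * \<theta> n\<bar> \<le> \<bar>C\<bar> * \<Theta>"
            using elim by (auto simp: abs_mult intro!: mult_left_mono)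
          then show "0 \<le> \<theta> n" "\<theta> n \<le> K" "\<bar>C * \<theta> n\<bar> \<le> K"
            using elim by (auto simp: K_def)
        qed
        have "0 \<le> binomial_moment (M n) (N n) ?r"
          by (auto simp: binomial_moment_def)
        moreover have "binomial_moment (M n) (N n) ?r \<le> K ^ ?r / fact ?r"
        proof -
          have "binomial_moment (M n) (N n) ?r \<le> (C * \<theta> n) ^ ?r / fact ?r"
            using elim by blast
          also have "\<dots> \<le> \<bar>C * \<theta> n\<bar> ^ ?r / fact ?r"
            by (intro divide_right_mono) (auto simp flip: power_abs)
          also have "\<dots> \<le> K ^ ?r / fact ?r"
            using K by (intro divide_right_mono power_mono) auto
          finally show ?thesis .
        qed
        moreover have "0 \<le> \<theta> n ^ ?r / fact ?r" "\<theta> n ^ ?r / fact ?r \<le> K ^ ?r / fact ?r"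
          using K by (auto intro!: divide_right_mono power_mono)
        moreover have "\<bar>u - v\<bar> \<le> w * 2" if "0 \<le> u" "u \<le> w" "0 \<le> v" "v \<le> w" for u v w :: real
          using that by linarith
        ultimately have "\<bar>binomial_moment (M n) (N n) ?r - \<theta> n ^ ?r / fact ?r\<bar> \<le> K ^ ?r / fact ?r * 2"
          by blast
        then have "real (?r choose j) * \<bar>binomial_moment (M n) (N n) ?r - \<theta> n ^ ?r / fact ?r\<bar> \<le>
            real (?r choose j) * (K ^ ?r / fact ?r * 2)"
          by (rule mult_left_mono) simp
        then have "norm (d s n) \<le> real (?r choose j) * (K ^ ?r / fact ?r * 2)"
          by (simp only: d_def) (simp add: abs_mult power_abs)
        also have "\<dots> \<le> 2 ^ ?r * (K ^ ?r / fact ?r * 2)"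
          using K of_nat_mono[OF binomial_le_pow2[of ?r j], where 'a = real]
          by (intro mult_right_mono) auto
        finally show "norm (d s n) \<le> (2 * K) ^ ?r / fact ?r * 2"
          by (simp add: power_mult_distrib)
      qed
    qed
    then show ?thesis
      unfolding eventually_prod_filter
      by (intro exI[of _ "\<lambda>_. True"] exI conjI) auto
  qed
  moreover have "summable (\<lambda>s. (2 * K) ^ (j + s) / fact (j + s) * 2)"
  proof -
    have "summable (\<lambda>s. (2 * K) ^ s /\<^sub>R fact s)"
      by (rule summable_exp_generic)
    then have "summable (\<lambda>s. (2 * K) ^ (s + j) /\<^sub>R fact (s + j))"
      by (rule summable_ignore_initial_segment)
    then show ?thesis
      by (intro summable_mult2) (simp add: field_simps add.commute)
  qed
  ultimately have "((\<lambda>n. \<Sum>s. d s n) \<longlongrightarrow> 0) F"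
    using tannerys_theorem[of d "\<lambda>_. 0" F "\<lambda>s. (2 * K) ^ (j + s) / fact (j + s) * 2"] F by simp
  moreover have "\<forall>\<^sub>F n in F. (\<Sum>s. d s n) = measure (M n) {\<omega> \<in> space (M n). N n \<omega> = j} -
           exp (- \<theta> n) * \<theta> n ^ j / fact j"
    using N
  proof eventually_elim
    case (elim n)
    have "(\<lambda>s. d s n) sums (measure (M n) {\<omega> \<in> space (M n). N n \<omega> = j} -
           exp (- \<theta> n) * \<theta> n ^ j / fact j)"
      using sums_diff[OF prob_eq_sums_binomial_moment[OF elim, of j] poisson_weight_sums[of j "\<theta> n"]]
      unfolding d_def by (simp add: right_diff_distrib)
    then show ?case by (rule sums_unique[symmetric])
  qed
  ultimately show ?thesis
    by (rule Lim_transform_eventually)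
qed

lemma exp_minus_mult_power_tendsto_0:
  fixes \<theta> :: "'b \<Rightarrow> real"
  assumes "filterlim \<theta> at_top F"
  shows "((\<lambda>n. exp (- \<theta> n) * \<theta> n ^ j / fact j) \<longlongrightarrow> 0) F"
proof -
  have "((\<lambda>y::real. y ^ j / exp y / fact j) \<longlongrightarrow> 0 / fact j) at_top"
    by (intro tendsto_divide tendsto_power_div_exp_0 tendsto_const) auto
  from filterlim_compose[OF this assms] show ?thesis
    by (simp add: exp_minus field_simps)
qed

text \<open>Here \<open>\<theta>\<close> may have finite limit points and also be unbounded, so
  neither regime need hold along all of \<open>F\<close>. Subfilters take the place of
  subsequences.\<close>

lemma poisson_limit:
  assumes N: "\<forall>\<^sub>F n in F. bounded_count (M n) (N n)"
    and \<theta>: "\<forall>\<^sub>F n in F. 0 < \<theta> n"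
    and S: "\<And>r. ((\<lambda>n. fact r * binomial_moment (M n) (N n) r / \<theta> n ^ r) \<longlongrightarrow> 1) F"
    and bound: "\<forall>\<^sub>F n in F. \<forall>r. binomial_moment (M n) (N n) r \<le> (C * \<theta> n) ^ r / fact r"
  shows "((\<lambda>n. measure (M n) {\<omega> \<in> space (M n). N n \<omega> = j} -
           exp (- \<theta> n) * \<theta> n ^ j / fact j) \<longlongrightarrow> 0) F" (is "(?d \<longlongrightarrow> 0) F")
proof (rule tendstoI, rule ccontr)
  fix e :: real assume e: "e > 0" and not: "\<not> (\<forall>\<^sub>F n in F. dist (?d n) 0 < e)"
  \<comment> \<open>Pass to the part of \<open>F\<close> where the claim fails by \<open>e\<close>: there either \<open>\<theta>\<close> tends to infinity, and
    both terms vanish by concentration, or \<open>\<theta>\<close> is frequently bounded.\<close>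
  define F' where "F' = inf F (principal {n. \<not> dist (?d n) 0 < e})"
  have F': "F' \<noteq> bot" and le': "F' \<le> F"
    using not by (auto simp: F'_def trivial_limit_def eventually_inf_principal)
  have far: "\<forall>\<^sub>F n in F'. \<not> dist (?d n) 0 < e"
    by (auto simp: F'_def eventually_inf_principal)
  \<comment> \<open>Every nontrivial subfilter inherits the failure by \<open>e\<close>, so one such
    subfilter with limit \<open>0\<close> is a contradiction.\<close>
  have no_limit: "\<not> (?d \<longlongrightarrow> 0) F''" if "F'' \<noteq> bot" "F'' \<le> F'" for F''
  proof
    assume "(?d \<longlongrightarrow> 0) F''"
    then have "\<forall>\<^sub>F n in F''. dist (?d n) 0 < e" using e by (rule tendstoD)
    moreover have "\<forall>\<^sub>F n in F''. \<not> dist (?d n) 0 < e" using far that(2) by (rule filter_leD[rotated])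
    ultimately have "\<forall>\<^sub>F n in F''. False" by eventually_elim simp
    then show False using that(1) by (simp add: trivial_limit_def)
  qed
  show False
  proof (cases "filterlim \<theta> at_top F'")
    case True
    have S1: "((\<lambda>n. binomial_moment (M n) (N n) 1 / \<theta> n) \<longlongrightarrow> 1) F'"
      using tendsto_mono[OF le' S[of 1]] by simp
    have S2: "((\<lambda>n. 2 * binomial_moment (M n) (N n) 2 / \<theta> n ^ 2) \<longlongrightarrow> 1) F'"
      using tendsto_mono[OF le' S[of 2]] by simp
    have N': "\<forall>\<^sub>F n in F'. bounded_count (M n) (N n)" using N le' by (rule filter_leD[rotated])
    have dev: "((\<lambda>n. measure (M n) {\<omega> \<in> space (M n). \<bar>real (N n \<omega>) - \<theta> n\<bar> \<ge> 1/2 * \<theta> n}) \<longlongrightarrow> 0) F'"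
      by (rule deviation_prob_tendsto_0[OF N' True S1 S2]) simp
    have "((\<lambda>n. measure (M n) {\<omega> \<in> space (M n). N n \<omega> = j}) \<longlongrightarrow> 0) F'"
    proof (rule tendsto_sandwich[OF _ _ tendsto_const dev])
      \<comment> \<open>Once \<open>\<theta> n\<close> exceeds \<open>2 * j\<close>, the value
        \<open>j\<close> lies at distance at least \<open>\<theta> n / 2\<close> from it.\<close>
      have "\<forall>\<^sub>F n in F'. \<theta> n \<ge> 2 * real j + 1"
        using True by (auto simp: filterlim_at_top)
      with N' show "\<forall>\<^sub>F n in F'. measure (M n) {\<omega> \<in> space (M n). N n \<omega> = j} \<le>
          measure (M n) {\<omega> \<in> space (M n). \<bar>real (N n \<omega>) - \<theta> n\<bar> \<ge> 1/2 * \<theta> n}"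
      proof eventually_elim
        case (elim n)
        interpret prob_space "M n" using elim by (auto simp: bounded_count_def)
        have [measurable]: "N n \<in> measurable (M n) (count_space UNIV)"
          using elim by (auto simp: bounded_count_def)
        show ?case
          using elim by (intro finite_measure_mono) auto
      qed
    qed auto
    from tendsto_diff[OF this exp_minus_mult_power_tendsto_0[OF True, of j]]
    show False using no_limit[OF F'] by simp
  next
    case False
    then obtain \<Theta> where \<Theta>: "\<not> (\<forall>\<^sub>F n in F'. \<Theta> \<le> \<theta> n)" by (auto simp: filterlim_at_top)
    define F'' where "F'' = inf F' (principal {n. \<not> \<Theta> \<le> \<theta> n})"
    have F'': "F'' \<noteq> bot" and le'': "F'' \<le> F'"
      using \<Theta> by (auto simp: F''_def trivial_limit_def eventually_inf_principal)
    have le: "F'' \<le> F" using le' le'' by simp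
    have "\<forall>\<^sub>F n in F''. \<not> \<Theta> \<le> \<theta> n" by (auto simp: F''_def eventually_inf_principal)
    with filter_leD[OF le \<theta>] have "\<forall>\<^sub>F n in F''. 0 < \<theta> n \<and> \<theta> n \<le> \<Theta>"
      by eventually_elim auto
    then have "(?d \<longlongrightarrow> 0) F''"
      using filter_leD[OF le N] tendsto_mono[OF le S] filter_leD[OF le bound]
      by (intro poisson_limit_bounded_mean[OF F'']) 
    then show False using no_limit[OF F'' le''] by simp
  qed
qed

text \<open>The sum is the Poisson probability of the values from \<open>1\<close> to
  \<open>t\<close>. It is small for large \<open>\<theta>\<close>; for \<open>\<theta>\<close> below
  a threshold the complement contains the value \<open>0\<close>, of weight
  \<open>exp (- \<theta>)\<close>. This uniform gap later converts an additive error into a relative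
  one.\<close>

lemma poisson_gap_bounded_below:
  "\<exists>\<delta>>0. \<forall>\<theta>\<ge>0. \<delta> \<le> 1 - (\<Sum>j=1..t. exp (- \<theta>) * \<theta> ^ j / fact j :: real)"
proof -
  let ?S = "\<lambda>\<theta>. \<Sum>j=1..t. exp (- \<theta>) * \<theta> ^ j / fact j :: real"
  have "(?S \<longlongrightarrow> (\<Sum>j=1..t. 0)) at_top"
    by (intro tendsto_sum exp_minus_mult_power_tendsto_0 filterlim_ident)
  then have "\<forall>\<^sub>F \<theta> in at_top. ?S \<theta> < 1 / 2"
    by (intro order_tendstoD(2)[where y = 0]) auto
  then obtain \<Theta> where \<Theta>: "\<And>\<theta>. \<theta> \<ge> \<Theta> \<Longrightarrow> ?S \<theta> < 1 / 2"
    by (auto simp: eventually_at_top_linorder)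
  have "min (1 / 2) (exp (- \<Theta>)) \<le> 1 - ?S \<theta>" if "\<theta> \<ge> 0" for \<theta>
  proof (cases "\<theta> \<ge> \<Theta>")
    case True
    then show ?thesis using \<Theta>[of \<theta>] by simp
  next
    case False
    have "(\<Sum>j\<in>{..t}. \<theta> ^ j /\<^sub>R fact j) \<le> exp \<theta>"
      unfolding exp_def using that by (intro sum_le_suminf summable_exp_generic) auto
    then have "exp (- \<theta>) * (\<Sum>j\<in>{..t}. \<theta> ^ j /\<^sub>R fact j) \<le> exp (- \<theta>) * exp \<theta>"
      by (intro mult_left_mono) auto
    also have "exp (- \<theta>) * exp \<theta> = 1" by (simp flip: exp_add)
    also have "exp (- \<theta>) * (\<Sum>j\<in>{..t}. \<theta> ^ j /\<^sub>R fact j) = (\<Sum>j\<in>{..t}. exp (- \<theta>) * \<theta> ^ j / fact j)"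
      by (simp add: sum_distrib_left divide_inverse mult_ac)
    also have "\<dots> = exp (- \<theta>) + ?S \<theta>"
      by (simp add: sum.atLeast1_atMost_eq sum.atMost_shift lessThan_Suc_atMost atMost_atLeast0 sum.atLeast_Suc_atMost)
    finally have "exp (- \<theta>) \<le> 1 - ?S \<theta>" by simp
    moreover have "exp (- \<Theta>) \<le> exp (- \<theta>)" using False by simp
    ultimately show ?thesis by linarith
  qed
  then show ?thesis by (intro exI[of _ "min (1 / 2) (exp (- \<Theta>))"]) auto
qed

section \<open>Marginals of the multinomial distribution\<close>

lemma (in finite_measure) measure_fibers_sums:
  assumes [measurable]: "Measurable.pred M P" "X \<in> measurable M (count_space (UNIV :: nat set))"
  shows "(\<lambda>b. measure M {\<omega> \<in> space M. P \<omega> \<and> X \<omega> = b}) sums measure M {\<omega> \<in> space M. P \<omega>}"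
proof -
  have "(\<lambda>b. measure M {\<omega> \<in> space M. P \<omega> \<and> X \<omega> = b}) sums
      measure M (\<Union>b. {\<omega> \<in> space M. P \<omega> \<and> X \<omega> = b})"
    by (intro finite_measure_UNION) (auto simp: disjoint_family_on_def)
  also have "(\<Union>b. {\<omega> \<in> space M. P \<omega> \<and> X \<omega> = b}) = {\<omega> \<in> space M. P \<omega>}"
    by auto
  finally show ?thesis .
qed

lemma (in finite_measure) measure_greater_sums:
  assumes [measurable]: "X \<in> measurable M (count_space (UNIV :: nat set))"
  shows "(\<lambda>b. measure M {\<omega> \<in> space M. X \<omega> = a + 1 + b}) sums measure M {\<omega> \<in> space M. a < X \<omega>}"
proof -
  have "(\<lambda>b. measure M {\<omega> \<in> space M. a < X \<omega> \<and> X \<omega> - (a + 1) = b}) sums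
      measure M {\<omega> \<in> space M. a < X \<omega>}"
    by (intro measure_fibers_sums) measurable
  moreover have "{\<omega> \<in> space M. a < X \<omega> \<and> X \<omega> - (a + 1) = b} = {\<omega> \<in> space M. X \<omega> = a + 1 + b}" for b
    by auto
  ultimately show ?thesis by simp
qed

text \<open>Only the restriction of the sample to \<open>I\<close> matters and it takes countably
  many values, so each preimage is a countable union of cylinder sets. This covers counts and order
  statistics alike.\<close>

lemma measurable_finitely_determined:
  fixes Y :: "'i \<Rightarrow> 'a \<Rightarrow> nat"
  assumes "finite I" and Y: "\<And>i. i \<in> I \<Longrightarrow> Y i \<in> measurable M (count_space UNIV)"
    and f: "\<And>y y'. (\<And>i. i \<in> I \<Longrightarrow> y i = y' i) \<Longrightarrow> f y = f y'"
  shows "(\<lambda>\<omega>. f (\<lambda>i. Y i \<omega>)) \<in> measurable M (count_space UNIV)"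
proof (rule measurableI)
  fix A
  let ?Z = "{y \<in> I \<rightarrow>\<^sub>E UNIV. f y \<in> A}"
  have "countable ?Z"
    using \<open>finite I\<close> by (intro countable_subset[OF _ countable_PiE[of I "\<lambda>_. UNIV"]]) auto
  moreover have "{\<omega> \<in> space M. \<forall>i\<in>I. Y i \<omega> = y i} \<in> sets M" for y
  proof -
    have "Measurable.pred M (\<lambda>\<omega>. Y i \<omega> = y i)" if "i \<in> I" for i
      using Y[OF that] by measurable
    then show ?thesis
      using \<open>finite I\<close> by (intro sets.sets_Collect_finite_All' sets.sets_Collect_finite_All) auto
  qed
  ultimately have "(\<Union>y\<in>?Z. {\<omega> \<in> space M. \<forall>i\<in>I. Y i \<omega> = y i}) \<in> sets M"
    by (intro sets.countable_UN') auto
  also have "(\<Union>y\<in>?Z. {\<omega> \<in> space M. \<forall>i\<in>I. Y i \<omega> = y i}) = (\<lambda>\<omega>. f (\<lambda>i. Y i \<omega>)) -` A \<inter> space M"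
  proof (intro equalityI subsetI)
    fix \<omega> assume "\<omega> \<in> (\<Union>y\<in>?Z. {\<omega> \<in> space M. \<forall>i\<in>I. Y i \<omega> = y i})"
    then obtain y where "f y \<in> A" "\<omega> \<in> space M" "\<And>i. i \<in> I \<Longrightarrow> Y i \<omega> = y i" by auto
    then show "\<omega> \<in> (\<lambda>\<omega>. f (\<lambda>i. Y i \<omega>)) -` A \<inter> space M"
      using f[of "\<lambda>i. Y i \<omega>" y] by auto
  next
    fix \<omega> assume \<omega>: "\<omega> \<in> (\<lambda>\<omega>. f (\<lambda>i. Y i \<omega>)) -` A \<inter> space M"
    have "f (restrict (\<lambda>i. Y i \<omega>) I) = f (\<lambda>i. Y i \<omega>)" by (rule f) auto
    with \<omega> show "\<omega> \<in> (\<Union>y\<in>?Z. {\<omega> \<in> space M. \<forall>i\<in>I. Y i \<omega> = y i})"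
      by (intro UN_I[of "restrict (\<lambda>i. Y i \<omega>) I"]) auto
  qed
  finally show "(\<lambda>\<omega>. f (\<lambda>i. Y i \<omega>)) -` A \<inter> space M \<in> sets M" .
qed auto

text \<open>The cells outside \<open>J\<close> act as one cell of probability
  \<open>1 - sum p J\<close>. They are summed out one at a time, each time by the binomial
  theorem.\<close>

lemma multinomial_marginal:
  assumes mult: "multinomial M I k p Y" and I: "finite I" and p: "(\<Sum>i\<in>I. p i) = 1"
    and "J \<subseteq> I"
  shows "measure M {\<omega> \<in> space M. \<forall>i\<in>J. Y i \<omega> = y i} =
    (if sum y J \<le> k
     then fact k / ((\<Prod>i\<in>J. fact (y i)) * fact (k - sum y J)) * (\<Prod>i\<in>J. p i ^ y i) *
       (1 - sum p J) ^ (k - sum y J)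
     else 0)"
proof -
  interpret prob_space M using mult by (simp add: multinomial_def)
  have Y: "Y i \<in> measurable M (count_space UNIV)" if "i \<in> I" for i
    using mult that by (auto simp: multinomial_def)
  \<comment> \<open>\<open>K\<close> is the set of cells already summed out. The values
    \<open>y\<close> stay arbitrary because the hypothesis is applied at \<open>y(i := b)\<close>
    for every content \<open>b\<close> of the next cell.\<close>
  have "finite K \<Longrightarrow> K \<subseteq> I \<Longrightarrow> measure M {\<omega> \<in> space M. \<forall>i\<in>I-K. Y i \<omega> = y i} =
    (if sum y (I - K) \<le> k
     then fact k / ((\<Prod>i\<in>I-K. fact (y i)) * fact (k - sum y (I-K))) * (\<Prod>i\<in>I-K. p i ^ y i) *
       (1 - sum p (I-K)) ^ (k - sum y (I-K))
     else 0)" for K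
  proof (induction K arbitrary: y rule: finite_induct)
    case empty
    have "measure M {\<omega> \<in> space M. \<forall>i\<in>I. Y i \<omega> = y i} =
        (if sum y I = k then fact k / (\<Prod>i\<in>I. fact (y i)) * (\<Prod>i\<in>I. p i ^ y i) else 0)"
      using mult by (simp add: multinomial_def)
    \<comment> \<open>With nothing summed out, the leftover probability is \<open>0\<close>, and
      \<open>0 ^ (k - sum y I)\<close> with \<open>sum y I \<le> k\<close> is \<open>1\<close>
      exactly when the contents add up to \<open>k\<close>.\<close>
    then show ?case
      by (auto simp: p)
  next
    case (insert i K)
    define J where "J = I - insert i K"
    define s where "s = sum y J"
    define c where "c = fact k / (\<Prod>i\<in>J. fact (y i)) * (\<Prod>i\<in>J. p i ^ y i)"
    define q where "q = 1 - sum p J"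
    have J: "I - K = insert i J" "i \<notin> J" "finite J" "J \<subseteq> I" "i \<in> I"
      using insert I by (auto simp: J_def)
    \<comment> \<open>Products and sums over \<open>J\<close> do not see the update of
      \<open>y\<close> at \<open>i\<close>; the conditional is the form in which the simplifier
      leaves \<open>y(i := b)\<close>.\<close>
    have prodc: "(\<Prod>j\<in>J. f j (if j = i then b else y j)) = (\<Prod>j\<in>J. f j (y j))"
      for f :: "_ \<Rightarrow> nat \<Rightarrow> real" and b
      using J by (intro prod.cong) auto
    have sumc: "(\<Sum>j\<in>J. (if j = i then b else y j)) = s" for b
      unfolding s_def using J by (intro sum.cong) auto
    have fiber: "measure M {\<omega> \<in> space M. (\<forall>j\<in>J. Y j \<omega> = y j) \<and> Y i \<omega> = b} =
       (if s + b \<le> k then c / (fact b * fact (k - s - b)) * p i ^ b * (q - p i) ^ (k - s - b) else 0)" for b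
    proof -
      have "{\<omega> \<in> space M. (\<forall>j\<in>J. Y j \<omega> = y j) \<and> Y i \<omega> = b} =
          {\<omega> \<in> space M. \<forall>j\<in>I-K. Y j \<omega> = (y(i := b)) j}"
        using J by auto
      moreover have "sum (y(i := b)) (I - K) = s + b"
        using J sumc[of b] by simp
      moreover have "(\<Prod>j\<in>I-K. fact ((y(i := b)) j)) = fact b * (\<Prod>j\<in>J. fact (y j) :: real)"
        using J prodc[of "\<lambda>j z. fact z" b] by simp
      moreover have "(\<Prod>j\<in>I-K. p j ^ (y(i := b)) j) = p i ^ b * (\<Prod>j\<in>J. p j ^ y j)"
        using J prodc[of "\<lambda>j z. p j ^ z" b] by simp
      moreover have "1 - sum p (I - K) = q - p i"
        using J by (simp add: q_def)
      moreover have "K \<subseteq> I" using insert.prems by simp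
      ultimately show ?thesis
        using insert.IH[of "y(i := b)"] by (simp only: c_def diff_diff_eq) (simp add: mult_ac)
    qed
    have "(\<lambda>b. measure M {\<omega> \<in> space M. (\<forall>j\<in>J. Y j \<omega> = y j) \<and> Y i \<omega> = b}) sums
        measure M {\<omega> \<in> space M. \<forall>j\<in>J. Y j \<omega> = y j}"
    proof (rule measure_fibers_sums)
      have "Measurable.pred M (\<lambda>\<omega>. Y j \<omega> = y j)" if "j \<in> J" for j
        using Y[of j] that J by (auto)
      then show "Measurable.pred M (\<lambda>\<omega>. \<forall>j\<in>J. Y j \<omega> = y j)"
        using J by (intro pred_intros_finite) auto
    qed (use Y J in auto)
    moreover have "(\<lambda>b. measure M {\<omega> \<in> space M. (\<forall>j\<in>J. Y j \<omega> = y j) \<and> Y i \<omega> = b}) sums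
        (\<Sum>b\<le>k. if s + b \<le> k then c / (fact b * fact (k - s - b)) * p i ^ b * (q - p i) ^ (k - s - b) else 0)"
      unfolding fiber by (intro sums_finite) auto
    ultimately have "measure M {\<omega> \<in> space M. \<forall>j\<in>J. Y j \<omega> = y j} =
        (\<Sum>b\<le>k. if s + b \<le> k then c / (fact b * fact (k - s - b)) * p i ^ b * (q - p i) ^ (k - s - b) else 0)"
      by (rule sums_unique2)
    also have "\<dots> = (if s \<le> k then c / fact (k - s) * q ^ (k - s) else 0)"
    proof (cases "s \<le> k")
      case True
      have "(\<Sum>b\<le>k. if s + b \<le> k then c / (fact b * fact (k - s - b)) * p i ^ b * (q - p i) ^ (k - s - b) else 0)
          = (\<Sum>b\<le>k-s. c / (fact b * fact (k - s - b)) * p i ^ b * (q - p i) ^ (k - s - b))"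
        using True by (intro sum.mono_neutral_cong_right) auto
      \<comment> \<open>The terms are those of the binomial expansion of
        \<open>(p i + (q - p i)) ^ (k - s)\<close>, which merges cell \<open>i\<close> with the
        rest.\<close>
      also have "\<dots> = (\<Sum>b\<le>k-s. c / fact (k - s) *
          (real (k - s choose b) * p i ^ b * (q - p i) ^ (k - s - b)))"
        by (intro sum.cong refl) (simp add: binomial_fact)
      also have "\<dots> = c / fact (k - s) * (p i + (q - p i)) ^ (k - s)"
        by (simp only: binomial_ring sum_distrib_left)
      finally show ?thesis using True by simp
    qed auto
    finally show ?case
      unfolding J_def[symmetric] s_def[symmetric] c_def q_def by (simp add: mult_ac)
  qed
  from this[of "I - J"] show ?thesis
    using \<open>J \<subseteq> I\<close> I by (simp add: double_diff)
qed

section \<open>Equiprobable cells: occupancy moments and their asymptotics\<close>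

text \<open>The probability that \<open>r\<close> given cells out of \<open>n\<close> equiprobable ones all receive exactly
  \<open>a\<close> of the \<open>k\<close> balls.\<close>

definition equal_cells_prob :: "nat \<Rightarrow> nat \<Rightarrow> nat \<Rightarrow> nat \<Rightarrow> real"
  where "equal_cells_prob n k a r =
    (if r * a \<le> k
     then fact k / (fact a ^ r * fact (k - r * a)) * (1 / real n) ^ (r * a) *
       (1 - real r / real n) ^ (k - r * a)
     else 0)"

locale uniform_multinomial =
  fixes M :: "'a measure" and n k :: nat and Y :: "nat \<Rightarrow> 'a \<Rightarrow> nat"
  assumes n_pos: "n > 0"
    and mult: "multinomial M {1..n} k (\<lambda>_. 1 / real n) Y"
begin

sublocale prob_space M
  using mult by (simp add: multinomial_def)

lemma measurable_Y: "i \<in> {1..n} \<Longrightarrow> Y i \<in> measurable M (count_space UNIV)"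
  using mult by (auto simp: multinomial_def)

lemma measurable_fun_Y:
  assumes "\<And>y y'. (\<And>i. i \<in> {1..n} \<Longrightarrow> y i = y' i) \<Longrightarrow> f y = f y'"
  shows "(\<lambda>\<omega>. f (\<lambda>i. Y i \<omega>)) \<in> measurable M (count_space UNIV)"
  by (rule measurable_finitely_determined[where I = "{1..n}", OF _ measurable_Y assms]) auto

lemma prob_equal_cells:
  assumes "J \<subseteq> {1..n}"
  shows "measure M {\<omega> \<in> space M. \<forall>i\<in>J. Y i \<omega> = a} = equal_cells_prob n k a (card J)"
proof -
  have "(1 / real n) ^ (card J * a) = ((1 / real n) ^ a) ^ card J"
    by (simp add: mult.commute flip: power_mult)
  then show ?thesis
    unfolding equal_cells_prob_def using n_pos
    by (subst multinomial_marginal[OF mult _ _ assms, of "\<lambda>_. a"]) (auto simp: power_mult mult_ac simp flip: power_mult)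
qed

lemma bounded_count_card:
  "bounded_count M (\<lambda>\<omega>. card {i \<in> {1..n}. P (Y i \<omega>)})"
proof -
  have "(\<lambda>\<omega>. card {i \<in> {1..n}. P (Y i \<omega>)}) \<in> measurable M (count_space UNIV)"
    by (rule measurable_fun_Y[of "\<lambda>y. card {i \<in> {1..n}. P (y i)}"])
       (auto intro!: arg_cong[where f = card])
  moreover have "card {i \<in> {1..n}. P (Y i \<omega>)} \<le> n" for \<omega>
  proof -
    have "card {i \<in> {1..n}. P (Y i \<omega>)} \<le> card {1..n}"
      by (intro card_mono) auto
    then show ?thesis by simp
  qed
  ultimately show ?thesis
    unfolding bounded_count_def using prob_space_axioms by blast
qed

lemma sets_all_eq: "J \<subseteq> {1..n} \<Longrightarrow> {\<omega> \<in> space M. \<forall>i\<in>J. Y i \<omega> = a} \<in> sets M"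
  using measurable_sets[OF measurable_fun_Y[of "\<lambda>y. \<forall>i\<in>J. y i = a"], of "{True}"]
  by (auto simp: vimage_def Int_def conj_commute subset_iff)

text \<open>The binomial coefficient counts the \<open>r\<close>-element sets of cells that all have
  content \<open>a\<close>. By linearity the moment is a sum over these sets, and all of them have
  the same probability.\<close>

lemma binomial_moment_card_eq:
  "binomial_moment M (\<lambda>\<omega>. card {i \<in> {1..n}. Y i \<omega> = a}) r =
     real (n choose r) * equal_cells_prob n k a r"
proof -
  let ?J = "{J. J \<subseteq> {1..n} \<and> card J = r}"
  let ?A = "\<lambda>J. {\<omega> \<in> space M. \<forall>i\<in>J. Y i \<omega> = a}"
  have fin: "finite ?J" by (rule finite_subset[of _ "Pow {1..n}"]) auto
  have "binomial_moment M (\<lambda>\<omega>. card {i \<in> {1..n}. Y i \<omega> = a}) r =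
      (\<integral>\<omega>. (\<Sum>J\<in>?J. indicator (?A J) \<omega>) \<partial>M)"
    unfolding binomial_moment_def
  proof (rule Bochner_Integration.integral_cong)
    fix \<omega> assume \<omega>: "\<omega> \<in> space M"
    let ?B = "{i \<in> {1..n}. Y i \<omega> = a}"
    have "card ?B choose r = card {J. J \<subseteq> ?B \<and> card J = r}"
      by (rule n_subsets[symmetric]) auto
    also have "{J. J \<subseteq> ?B \<and> card J = r} = {J\<in>?J. \<omega> \<in> ?A J}"
      using \<omega> by auto
    also have "real (card {J\<in>?J. \<omega> \<in> ?A J}) = (\<Sum>J\<in>?J. indicator (?A J) \<omega>)"
      using fin by (simp add: sum.If_cases indicator_def Int_def)
    finally show "real (card ?B choose r) = (\<Sum>J\<in>?J. indicator (?A J) \<omega>)" by simp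
  qed simp
  also have "\<dots> = (\<Sum>J\<in>?J. measure M (?A J))"
    using sets_all_eq by (subst Bochner_Integration.integral_sum) (auto simp: emeasure_eq_measure)
  also have "\<dots> = (\<Sum>J\<in>?J. equal_cells_prob n k a r)"
    by (intro sum.cong) (auto simp: prob_equal_cells)
  also have "\<dots> = real (n choose r) * equal_cells_prob n k a r"
    using n_subsets[of "{1..n}" r] by simp
  finally show ?thesis .
qed

end

text \<open>The falling factorial is at most \<open>k ^ (r * a)\<close>, and the last factor is a
  power of a number between \<open>0\<close> and \<open>1\<close>.\<close>

lemma equal_cells_prob_le:
  assumes "n > 0" "r \<le> n"
  shows "equal_cells_prob n k a r \<le> ((real k / real n) ^ a / fact a) ^ r"
proof (cases "r * a \<le> k")
  case True
  have "fact k / fact (k - r * a) \<le> (real k ^ (r * a) :: real)"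
  proof -
    have "real (fact k div fact (k - r * a)) \<le> real (k ^ (r * a))"
      using True fact_div_fact_le_pow[of "r * a" k] by (intro of_nat_mono) auto
    then show ?thesis
      by (simp add: real_of_nat_div fact_dvd)
  qed
  moreover have "0 \<le> 1 - real r / real n" "1 - real r / real n \<le> 1"
    using assms by auto
  ultimately have "fact k / fact (k - r * a) * ((1 / real n) ^ (r * a) / fact a ^ r) *
      (1 - real r / real n) ^ (k - r * a) \<le>
      real k ^ (r * a) * ((1 / real n) ^ (r * a) / fact a ^ r) * 1"
    by (intro mult_mono mult_nonneg_nonneg power_le_one) auto
  also have "\<dots> = ((real k / real n) ^ a / fact a) ^ r"
    by (simp add: power_divide mult.commute[of r] power_mult power_mult_distrib)
  finally show ?thesis
    using True by (simp add: equal_cells_prob_def mult_ac)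
qed (auto simp: equal_cells_prob_def)

text \<open>Valid for every \<open>r\<close>, since the binomial coefficient vanishes beyond
  \<open>n\<close>; this yields the majorant for the Poisson limit.\<close>

lemma choose_mult_equal_cells_prob_le:
  assumes "n > 0"
  shows "real (n choose r) * equal_cells_prob n k a r \<le>
    (real n * ((real k / real n) ^ a / fact a)) ^ r / fact r"
proof (cases "r \<le> n")
  case True
  have "real ((n choose r) * fact r) \<le> real (n ^ r)"
    using binomial_fact_pow by (intro of_nat_mono) auto
  then have "real (n choose r) \<le> real n ^ r / fact r"
    by (simp add: field_simps)
  then have "real (n choose r) * equal_cells_prob n k a r \<le>
      real n ^ r / fact r * ((real k / real n) ^ a / fact a) ^ r"
    using True assms equal_cells_prob_le by (intro mult_mono') (auto simp: equal_cells_prob_def)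
  then show ?thesis by (simp only: power_mult_distrib times_divide_eq_left)
qed (auto simp: binomial_eq_0)

text \<open>The ratio is the product of the factors \<open>1 - i / k\<close> for
  \<open>i < s\<close>. Each step of the induction costs at most \<open>s / k\<close>, and these
  losses add up to at most \<open>s ^ 2 / k\<close>.\<close>

lemma falling_factorial_ratio_bounds:
  assumes "s \<le> k" "k > 0"
  shows "1 - real s ^ 2 / real k \<le> fact k / (fact (k - s) * real k ^ s)"
    and "fact k / (fact (k - s) * real k ^ s) \<le> 1"
proof -
  have "1 - real s ^ 2 / real k \<le> fact k / (fact (k - s) * real k ^ s) \<and>
      fact k / (fact (k - s) * real k ^ s) \<le> 1"
    using \<open>s \<le> k\<close>
  proof (induction s)
    case (Suc s)
    let ?f = "\<lambda>s. fact k / (fact (k - s) * real k ^ s)"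
    have "fact (k - s) = real (k - s) * fact (k - Suc s)"
      using Suc.prems fact_reduce[of "k - s", where 'a = real] by simp
    moreover have "1 - real s / real k = real (k - s) / real k" "real (k - s) > 0"
      using Suc.prems by (auto simp: of_nat_diff field_simps)
    ultimately have f: "?f (Suc s) = ?f s * (1 - real s / real k)"
      by (simp add: mult_ac)
    have "1 - real (Suc s) ^ 2 / real k \<le> (1 - real s ^ 2 / real k) * (1 - real s / real k)"
    proof -
      have "(1 - real s ^ 2 / real k) * (1 - real s / real k) =
          1 - (real s ^ 2 + real s) / real k + real s ^ 2 / real k * (real s / real k)"
        by (simp add: algebra_simps add_divide_distrib diff_divide_distrib)
      moreover have "(real s ^ 2 + real s) / real k \<le> real (Suc s) ^ 2 / real k"
        by (intro divide_right_mono) (auto simp: power2_eq_square algebra_simps)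
      moreover have "0 \<le> real s ^ 2 / real k * (real s / real k)" by simp
      ultimately show ?thesis by linarith
    qed
    also have "\<dots> \<le> ?f s * (1 - real s / real k)"
      using Suc by (intro mult_right_mono) auto
    finally have "1 - real (Suc s) ^ 2 / real k \<le> ?f (Suc s)" by (simp only: f)
    moreover have "?f s * (1 - real s / real k) \<le> 1 * 1"
      using Suc by (intro mult_mono) auto
    ultimately show ?case by (simp only: f) simp
  qed (use assms in auto)
  then show "1 - real s ^ 2 / real k \<le> fact k / (fact (k - s) * real k ^ s)"
    and "fact k / (fact (k - s) * real k ^ s) \<le> 1" by auto
qed

lemma falling_factorial_ratio_tendsto:
  assumes s: "((\<lambda>n. real (s n) ^ 2 / real (k n)) \<longlongrightarrow> 0) F"
    and le: "\<forall>\<^sub>F n in F. s n \<le> k n" and pos: "\<forall>\<^sub>F n in F. k n > 0"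
  shows "((\<lambda>n. fact (k n) / (fact (k n - s n) * real (k n) ^ s n)) \<longlongrightarrow> (1 :: real)) F"
proof (rule tendsto_sandwich)
  show "((\<lambda>n. 1 - real (s n) ^ 2 / real (k n)) \<longlongrightarrow> 1) F"
    using tendsto_diff[OF tendsto_const s, of 1] by simp
  show "\<forall>\<^sub>F n in F. 1 - real (s n) ^ 2 / real (k n) \<le> fact (k n) / (fact (k n - s n) * real (k n) ^ s n)"
    using le pos by eventually_elim (rule falling_factorial_ratio_bounds)
  show "\<forall>\<^sub>F n in F. fact (k n) / (fact (k n - s n) * real (k n) ^ s n) \<le> (1::real)"
    using le pos by eventually_elim (rule falling_factorial_ratio_bounds)
qed auto

text \<open>The quotient splits into four factors tending to \<open>1\<close>: the falling
  factorials of \<open>n\<close> and of \<open>k n\<close>, the comparison of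
  \<open>(1 - r / n) ^ k n\<close> with \<open>exp (- l * r)\<close>, and the correction
  \<open>(1 - r / n) ^ (r * a n)\<close>. The condition on \<open>a\<close> serves the second and
  the fourth.\<close>

lemma choose_mult_equal_cells_prob_asymptotic:
  fixes F :: "nat filter"
  assumes F: "F \<le> sequentially" and l: "l > 0"
    and k: "\<forall>\<^sub>F n in F. real (k n) = l * real n"
    and a: "((\<lambda>n. real (a n) ^ 2 / real n) \<longlongrightarrow> 0) F"
  shows "((\<lambda>n. fact r * (real (n choose r) * equal_cells_prob n (k n) (a n) r) /
    (real n * (l ^ a n / fact (a n) * exp (- l))) ^ r) \<longlongrightarrow> 1) F"
proof -
  have pos: "\<forall>\<^sub>F n in F. n > 0" and large: "\<forall>\<^sub>F n in F. r < n"
    by (auto intro!: filter_leD[OF F] eventually_gt_at_top)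
  have kpos: "\<forall>\<^sub>F n in F. k n > 0"
    using k pos by eventually_elim (use l in \<open>auto intro!: gr0I\<close>)
  have sa: "((\<lambda>n. real (r * a n) ^ 2 / real (k n)) \<longlongrightarrow> 0) F"
  proof -
    have "((\<lambda>n. real r ^ 2 / l * (real (a n) ^ 2 / real n)) \<longlongrightarrow> real r ^ 2 / l * 0) F"
      by (intro tendsto_intros a)
    then have "((\<lambda>n. real r ^ 2 / l * (real (a n) ^ 2 / real n)) \<longlongrightarrow> 0) F" by simp
    then show ?thesis
    proof (rule Lim_transform_eventually)
      show "\<forall>\<^sub>F n in F. real r ^ 2 / l * (real (a n) ^ 2 / real n) = real (r * a n) ^ 2 / real (k n)"
        using k by eventually_elim (simp add: power_mult_distrib)
    qed
  qed
  have le: "\<forall>\<^sub>F n in F. r * a n \<le> k n"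
  proof -
    have "\<forall>\<^sub>F n in F. real (r * a n) ^ 2 / real (k n) < 1"
      using order_tendstoD(2)[OF sa, of 1] by simp
    then show ?thesis using kpos
    proof eventually_elim
      case (elim n)
      \<comment> \<open>A natural number is at most its square, so \<open>r * a n \<le> k n\<close>
        follows.\<close>
      then have "(r * a n) ^ 2 < k n"
        by (simp only: divide_less_eq_1_pos of_nat_0_less_iff of_nat_less_iff flip: of_nat_power)
      then show ?case
        using self_le_power[of "r * a n" 2] by (cases "r * a n = 0") (auto simp del: mult_eq_0_iff)
    qed
  qed
  have lim1: "((\<lambda>n. fact n / (fact (n - r) * real n ^ r)) \<longlongrightarrow> (1::real)) F"
  proof (rule falling_factorial_ratio_tendsto)
    have "(\<lambda>n. real r ^ 2 / real n) \<longlonglongrightarrow> 0"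
      by (rule lim_const_over_n)
    then show "((\<lambda>n. real r ^ 2 / real n) \<longlongrightarrow> 0) F" by (rule tendsto_mono[OF F])
    show "\<forall>\<^sub>F n in F. r \<le> n" using large by eventually_elim simp
  qed (rule pos)
  have lim2: "((\<lambda>n. fact (k n) / (fact (k n - r * a n) * real (k n) ^ (r * a n))) \<longlongrightarrow> (1::real)) F"
    by (rule falling_factorial_ratio_tendsto[OF sa le kpos])
  have lim3: "((\<lambda>n. exp (l * real r) * (1 - real r / real n) ^ k n) \<longlongrightarrow> 1) F"
  proof -
    have "((\<lambda>n. (1 + (- real r) / real n) ^ n) \<longlongrightarrow> exp (- real r)) F"
      by (rule tendsto_mono[OF F tendsto_exp_limit_sequentially])
    \<comment> \<open>Since \<open>k n = l * n\<close>, the power \<open>k n\<close> is the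
      \<open>l\<close>-th real power of the power \<open>n\<close>; \<open>powr\<close> is used
      because \<open>l\<close> need not be an integer.\<close>
    then have "((\<lambda>n. exp (l * real r) * ((1 + (- real r) / real n) ^ n) powr l) \<longlongrightarrow>
        exp (l * real r) * exp (- real r) powr l) F"
      by (intro tendsto_intros) auto
    moreover have "exp (l * real r) * exp (- real r) powr l = 1"
      by (simp add: powr_def flip: exp_add)
    ultimately have "((\<lambda>n. exp (l * real r) * ((1 + (- real r) / real n) ^ n) powr l) \<longlongrightarrow> 1) F"
      by simp
    then show ?thesis
    proof (rule Lim_transform_eventually)
      show "\<forall>\<^sub>F n in F. exp (l * real r) * ((1 + (- real r) / real n) ^ n) powr l =
          exp (l * real r) * (1 - real r / real n) ^ k n"
        using k large
      proof eventually_elim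
        case (elim n)
        then have "1 - real r / real n > 0" by (simp add: field_simps)
        then show ?case
          using elim by (simp add: powr_powr mult.commute flip: powr_realpow)
      qed
    qed
  qed
  have lim4: "((\<lambda>n. (1 - real r / real n) ^ (r * a n)) \<longlongrightarrow> 1) F"
  proof (rule tendsto_sandwich)
    have "((\<lambda>n. 1 - real r ^ 2 * (real (a n) ^ 2 / real n)) \<longlongrightarrow> 1 - real r ^ 2 * 0) F"
      by (intro tendsto_intros a)
    then show "((\<lambda>n. 1 - real r ^ 2 * (real (a n) ^ 2 / real n)) \<longlongrightarrow> 1) F" by simp
    show "\<forall>\<^sub>F n in F. 1 - real r ^ 2 * (real (a n) ^ 2 / real n) \<le> (1 - real r / real n) ^ (r * a n)"
      using large
    proof eventually_elim
      case (elim n)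
      have "real (a n) \<le> real (a n) ^ 2"
        by (cases "a n") (auto simp: power2_eq_square)
      then have "real r ^ 2 * (real (a n) / real n) \<le> real r ^ 2 * (real (a n) ^ 2 / real n)"
        by (intro mult_left_mono divide_right_mono) auto
      \<comment> \<open>Bernoulli's inequality gives a loss linear in \<open>a n\<close>, which is
        weakened to a quadratic one to match the hypothesis.\<close>
      moreover have "1 + real (r * a n) * (- (real r / real n)) \<le> (1 + (- (real r / real n))) ^ (r * a n)"
        using elim by (intro Bernoulli_inequality) auto
      ultimately show ?case by (simp add: power2_eq_square mult_ac)
    qed
    show "\<forall>\<^sub>F n in F. (1 - real r / real n) ^ (r * a n) \<le> 1"
      using large by eventually_elim (auto intro!: power_le_one)
  qed auto
  have "((\<lambda>n. fact n / (fact (n - r) * real n ^ r) *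
      (fact (k n) / (fact (k n - r * a n) * real (k n) ^ (r * a n))) *
      (exp (l * real r) * (1 - real r / real n) ^ k n) /
      (1 - real r / real n) ^ (r * a n)) \<longlongrightarrow> 1 * 1 * 1 / 1) F"
    by (intro tendsto_intros lim1 lim2 lim3 lim4) auto
  then have "((\<lambda>n. fact n / (fact (n - r) * real n ^ r) *
      (fact (k n) / (fact (k n - r * a n) * real (k n) ^ (r * a n))) *
      (exp (l * real r) * (1 - real r / real n) ^ k n) /
      (1 - real r / real n) ^ (r * a n)) \<longlongrightarrow> 1) F" by simp
  then show ?thesis
  proof (rule Lim_transform_eventually)
    show "\<forall>\<^sub>F n in F. fact n / (fact (n - r) * real n ^ r) *
      (fact (k n) / (fact (k n - r * a n) * real (k n) ^ (r * a n))) *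
      (exp (l * real r) * (1 - real r / real n) ^ k n) /
      (1 - real r / real n) ^ (r * a n) =
      fact r * (real (n choose r) * equal_cells_prob n (k n) (a n) r) /
        (real n * (l ^ a n / fact (a n) * exp (- l))) ^ r"
      using k large le
    proof eventually_elim
      case (elim n)
      have q: "1 - real r / real n > 0" using elim by (simp add: field_simps)
      have ch: "fact r * real (n choose r) = fact n / fact (n - r)"
        using elim by (simp add: binomial_fact)
      have pw: "(1 - real r / real n) ^ k n / (1 - real r / real n) ^ (r * a n) =
          (1 - real r / real n) ^ (k n - r * a n)"
        using q elim by (simp add: power_diff)
      have ex: "exp (l * real r) = 1 / exp (- l) ^ r"
        by (simp add: exp_minus mult.commute[of l] power_inverse divide_inverse flip: exp_of_nat_mult)
      have kr: "real (k n) ^ (r * a n) = (l ^ a n) ^ r * real n ^ (r * a n)"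
        using elim by (simp add: power_mult_distrib mult.commute[of r] power_mult)
      have "fact r * (real (n choose r) * equal_cells_prob n (k n) (a n) r) /
        (real n * (l ^ a n / fact (a n) * exp (- l))) ^ r =
        (fact r * real (n choose r)) / real n ^ r *
        (fact (k n) / (fact (k n - r * a n) * ((l ^ a n) ^ r * real n ^ (r * a n)))) *
        (1 / exp (- l) ^ r * (1 - real r / real n) ^ (k n - r * a n))"
        using elim l by (simp add: equal_cells_prob_def power_mult_distrib power_divide mult_ac)
      then show ?case
        unfolding ch ex kr pw[symmetric] by simp
    qed
  qed
qed

section \<open>The Poisson tail and the cutoff sequences\<close>

definition poisson_tail :: "real \<Rightarrow> nat \<Rightarrow> real"
  where "poisson_tail l j = measure_pmf.prob (poisson_pmf l) {j<..}"

lemma poisson_tail_sums: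
  assumes "l > 0"
  shows "(\<lambda>b. l ^ (j + 1 + b) / fact (j + 1 + b) * exp (- l)) sums poisson_tail l j"
proof -
  have "(\<lambda>b. measure_pmf.prob (poisson_pmf l) {i. i = j + 1 + b}) sums
      measure_pmf.prob (poisson_pmf l) {i. j < i}"
    using measure_pmf.measure_greater_sums[of "\<lambda>i. i" "poisson_pmf l" j] by simp
  moreover have "measure_pmf.prob (poisson_pmf l) {i. i = b} = l ^ b / fact b * exp (- l)" for b
    using assms by (simp add: measure_pmf_single)
  ultimately show ?thesis
    by (simp only: poisson_tail_def greaterThan_def)
qed

lemma poisson_tail_Suc:
  assumes "l > 0"
  shows "poisson_tail l j = l ^ Suc j / fact (Suc j) * exp (- l) + poisson_tail l (Suc j)"
proof -
  have "(\<lambda>b. l ^ (Suc j + 1 + b) / fact (Suc j + 1 + b) * exp (- l)) sums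
      (poisson_tail l j - l ^ Suc j / fact (Suc j) * exp (- l))"
    using iffD2[OF sums_Suc_iff, of "\<lambda>b. l ^ (j + 1 + b) / fact (j + 1 + b) * exp (- l)"]
      poisson_tail_sums[OF assms, of j]
    by simp
  from sums_unique2[OF this poisson_tail_sums[OF assms]] show ?thesis by simp
qed

text \<open>By \<open>fact (Suc j) * fact b \<le> fact (Suc j + b)\<close>, the tail is at most its
  first term times the exponential series of \<open>l\<close>, whose sum cancels
  \<open>exp (- l)\<close>.\<close>

lemma poisson_tail_le:
  assumes "l > 0"
  shows "poisson_tail l j \<le> l ^ Suc j / fact (Suc j)"
proof -
  have "(\<lambda>b. l ^ b /\<^sub>R fact b * (exp (- l) * (l ^ Suc j / fact (Suc j)))) sums
      (exp l * (exp (- l) * (l ^ Suc j / fact (Suc j))))"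
    by (intro sums_mult2 exp_converges)
  also have "exp l * (exp (- l) * (l ^ Suc j / fact (Suc j))) = l ^ Suc j / fact (Suc j)"
    by (simp add: exp_minus)
  finally have *: "(\<lambda>b. l ^ b /\<^sub>R fact b * (exp (- l) * (l ^ Suc j / fact (Suc j)))) sums
      (l ^ Suc j / fact (Suc j))" .
  show ?thesis
  proof (rule sums_le[OF _ poisson_tail_sums[OF assms] *])
    fix b
    have "real (fact (Suc j) * fact b) \<le> real (fact (Suc j + b))"
      by (intro of_nat_mono dvd_imp_le fact_fact_dvd_fact) auto
    then have "fact (Suc j) * fact b \<le> (fact (Suc j + b) :: real)"
      by (simp only: of_nat_mult of_nat_fact)
    then have "l ^ (Suc j + b) * exp (- l) / fact (Suc j + b) \<le>
        l ^ (Suc j + b) * exp (- l) / (fact (Suc j) * fact b)"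
      using assms by (intro divide_left_mono) auto
    then show "l ^ (j + 1 + b) / fact (j + 1 + b) * exp (- l) \<le>
        l ^ b /\<^sub>R fact b * (exp (- l) * (l ^ Suc j / fact (Suc j)))"
      by (simp only: power_add divide_inverse inverse_mult_distrib Suc_eq_plus1 real_scaleR_def mult_ac)
  qed
qed

lemma poisson_tail_ge:
  assumes "l > 0"
  shows "l ^ Suc j / fact (Suc j) * exp (- l) \<le> poisson_tail l j"
  using poisson_tail_Suc[OF assms, of j] by (simp add: poisson_tail_def)

lemma poisson_tail_pos: "l > 0 \<Longrightarrow> poisson_tail l j > 0"
  by (rule less_le_trans[OF _ poisson_tail_ge]) auto

lemma poisson_tail_ratio_le:
  assumes "l > 0"
  shows "poisson_tail l (Suc j) / (l ^ Suc j / fact (Suc j) * exp (- l)) \<le> l * exp l / real (j + 2)"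
proof -
  have "poisson_tail l (Suc j) / (l ^ Suc j / fact (Suc j) * exp (- l)) \<le>
      l ^ Suc (Suc j) / fact (Suc (Suc j)) / (l ^ Suc j / fact (Suc j) * exp (- l))"
    using assms by (intro divide_right_mono poisson_tail_le) auto
  also have "\<dots> = l * exp l / real (j + 2)"
    using assms fact_Suc[of "Suc j", where 'a = real]
    by (simp add: exp_minus divide_simps del: fact_Suc)
  finally show ?thesis .
qed

lemma poisson_tail_ratio_bound_tendsto: "(\<lambda>j. l * exp l / real (j + 2)) \<longlonglongrightarrow> 0"
  using LIMSEQ_ignore_initial_segment[OF lim_const_over_n, of "l * exp l" 2] by simp

lemma poisson_tail_ratio_tendsto:
  assumes "l > 0"
  shows "(\<lambda>j. poisson_tail l (Suc j) / poisson_tail l j) \<longlonglongrightarrow> 0"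
proof (rule tendsto_sandwich[OF _ _ tendsto_const poisson_tail_ratio_bound_tendsto])
  show "\<forall>\<^sub>F j in sequentially. poisson_tail l (Suc j) / poisson_tail l j \<le> l * exp l / real (j + 2)"
  proof (intro always_eventually allI)
    fix j
    have "poisson_tail l (Suc j) / poisson_tail l j \<le>
        poisson_tail l (Suc j) / (l ^ Suc j / fact (Suc j) * exp (- l))"
      using assms poisson_tail_ge[OF assms, of j] poisson_tail_pos[OF assms, of "Suc j"]
      by (intro divide_left_mono mult_pos_pos poisson_tail_pos) auto
    also note poisson_tail_ratio_le[OF assms]
    finally show "poisson_tail l (Suc j) / poisson_tail l j \<le> l * exp l / real (j + 2)" .
  qed
  show "\<forall>\<^sub>F j in sequentially. 0 \<le> poisson_tail l (Suc j) / poisson_tail l j"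
    by (intro always_eventually) (auto simp: poisson_tail_def)
qed

text \<open>The tail is dominated by its first term. Hence \<open>theta_seq\<close> and
  \<open>z_seq\<close>, defined through tails, are asymptotic to the expected numbers of cells at a
  single value.\<close>

lemma poisson_pmf_tail_asymptotic:
  assumes "l > 0"
  shows "(\<lambda>j. l ^ Suc j / fact (Suc j) * exp (- l) / poisson_tail l j) \<longlonglongrightarrow> 1"
proof -
  have "(\<lambda>j. 1 - poisson_tail l (Suc j) / poisson_tail l j) \<longlonglongrightarrow> 1 - 0"
    by (intro tendsto_intros poisson_tail_ratio_tendsto assms)
  moreover have "1 - poisson_tail l (Suc j) / poisson_tail l j =
      l ^ Suc j / fact (Suc j) * exp (- l) / poisson_tail l j" for j
  proof -
    have "l ^ Suc j / fact (Suc j) * exp (- l) = poisson_tail l j - poisson_tail l (Suc j)"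
      using poisson_tail_Suc[OF assms, of j] by simp
    then show ?thesis
      using poisson_tail_pos[OF assms, of j] by (simp only: diff_divide_distrib) simp
  qed
  ultimately show ?thesis by simp
qed

text \<open>With \<open>j + 2 \<le> 2 ^ Suc j\<close>, the square costs only a factor
  \<open>4 ^ Suc j\<close>, which the factorial absorbs. It serves to show that the square of the
  cutoff is negligible against \<open>n\<close>.\<close>

lemma square_mult_poisson_tail_tendsto:
  assumes "l > 0"
  shows "(\<lambda>j. real (j + 2) ^ 2 * poisson_tail l j) \<longlonglongrightarrow> 0"
proof (rule tendsto_sandwich[OF _ _ tendsto_const])
  have "(\<lambda>j. (4 * l) ^ j /\<^sub>R fact j) \<longlonglongrightarrow> 0"
    by (rule summable_LIMSEQ_zero[OF summable_exp_generic])
  then show "(\<lambda>j. (4 * l) ^ Suc j /\<^sub>R fact (Suc j)) \<longlonglongrightarrow> 0"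
    by (rule LIMSEQ_Suc)
  show "\<forall>\<^sub>F j in sequentially. real (j + 2) ^ 2 * poisson_tail l j \<le> (4 * l) ^ Suc j /\<^sub>R fact (Suc j)"
  proof (intro always_eventually allI)
    fix j
    have "j + 2 \<le> 2 ^ Suc j"
      using less_exp[of "Suc j"] by simp
    then have "real (j + 2) \<le> real (2 ^ Suc j)" by (rule of_nat_mono)
    then have "real (j + 2) ^ 2 \<le> real (2 ^ Suc j) ^ 2" by (intro power_mono) auto
    also have "\<dots> = 4 ^ Suc j"
      by (simp add: power2_eq_square flip: power_mult_distrib)
    finally have "real (j + 2) ^ 2 * poisson_tail l j \<le> 4 ^ Suc j * (l ^ Suc j / fact (Suc j))"
      by (intro mult_mono poisson_tail_le assms) (auto simp: poisson_tail_def)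
    then show "real (j + 2) ^ 2 * poisson_tail l j \<le> (4 * l) ^ Suc j /\<^sub>R fact (Suc j)"
      by (simp only: power_mult_distrib divide_inverse real_scaleR_def mult_ac)
  qed
qed (auto simp: poisson_tail_def)

lemma poisson_cdf_nat: "1 - poisson_cdf l (real j) = poisson_tail l j"
proof -
  have "poisson_cdf l (real j) = measure_pmf.prob (poisson_pmf l) {..j}"
    unfolding poisson_cdf_def cdf_def
    by (subst measure_distr) (auto intro!: arg_cong[where f = "measure_pmf.prob _"])
  then show ?thesis
    using measure_pmf.prob_compl[of "{..j}" "poisson_pmf l"]
    by (simp add: poisson_tail_def Compl_eq_Diff_UNIV[symmetric] Compl_atMost)
qed

lemma tail_ratio_poisson:
  assumes "l > 0"
  shows "tail_ratio (poisson_cdf l) = 0"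
proof -
  have "(1 - poisson_cdf l (real n + 1)) / (1 - poisson_cdf l (real n)) =
      poisson_tail l (Suc n) / poisson_tail l n" for n
    using poisson_cdf_nat[of l "Suc n"] by (simp add: poisson_cdf_nat add.commute)
  then show ?thesis
    unfolding tail_ratio_def using limI[OF poisson_tail_ratio_tendsto[OF assms]] by simp
qed

section \<open>The cutoff sequences of an admissible extension of the Poisson tail\<close>

locale poisson_cutoff =
  fixes l :: real and G :: "real \<Rightarrow> real" and x :: "nat \<Rightarrow> real"
  assumes l_pos: "l > 0"
    and ext: "tail_extension (poisson_cdf l) G"
    and x: "\<And>n. n \<ge> 2 \<Longrightarrow> G (x n) = 1 / real n"
begin

text \<open>The integer \<open>m_seq x n\<close> may be negative for small \<open>n\<close>; the
  truncation is harmless eventually.\<close>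

definition m :: "nat \<Rightarrow> nat" where "m n = nat (m_seq x n)"

lemma G_antimono: "u \<le> v \<Longrightarrow> G v \<le> G u"
  using ext by (auto simp: tail_extension_def antimono_def)

lemma G_nat: "G (real j) = poisson_tail l j"
proof -
  have "G (of_int (int j)) = 1 - poisson_cdf l (of_int (int j))"
    using ext unfolding tail_extension_def by blast
  then show ?thesis by (simp add: poisson_cdf_nat)
qed

lemma G_pos: "G u > 0"
proof -
  have "0 < G (real (nat \<lceil>u\<rceil>))" by (simp add: G_nat poisson_tail_pos l_pos)
  also have "\<dots> \<le> G u" by (intro G_antimono) linarith
  finally show ?thesis .
qed

text \<open>A half step is the rounding slack in \<open>m_seq\<close>, and the limit is
  \<open>0 powr (1 / 2) = 0\<close>.\<close>

lemma G_half_step: "((\<lambda>u. G (u + 1 / 2) / G u) \<longlongrightarrow> 0) at_top"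
proof -
  have "((\<lambda>u. G (u + 1 / 2) / G u) \<longlongrightarrow> tail_ratio (poisson_cdf l) powr (1 / 2)) at_top"
    using ext unfolding tail_extension_def by simp
  then show ?thesis by (simp add: tail_ratio_poisson l_pos)
qed

text \<open>Each \<open>G Z\<close> is positive, so \<open>G (x n) = 1 / n\<close> eventually lies
  below it, and monotonicity puts \<open>x n\<close> to the right of \<open>Z\<close>.\<close>

lemma x_at_top: "filterlim x at_top sequentially"
  unfolding filterlim_at_top
proof
  fix Z
  have "\<forall>\<^sub>F n in sequentially. 1 / real n < G Z"
    by (rule order_tendstoD(2)[OF lim_const_over_n G_pos])
  then show "\<forall>\<^sub>F n in sequentially. Z \<le> x n"
    using eventually_ge_at_top[of 2]
  proof eventually_elim
    case (elim n)
    then have "G (x n) < G Z" by (simp add: x)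
    then show ?case using G_antimono[of "x n" Z] by fastforce
  qed
qed

lemma m_at_top: "filterlim m at_top sequentially"
  unfolding filterlim_at_top
proof
  fix Z
  have "\<forall>\<^sub>F n in sequentially. real Z \<le> x n"
    using x_at_top by (auto simp: filterlim_at_top)
  then show "\<forall>\<^sub>F n in sequentially. Z \<le> m n"
    by eventually_elim (simp add: m_def m_seq_def le_nat_iff le_floor_iff)
qed

lemma eventually_m:
  "\<forall>\<^sub>F n in sequentially. n \<ge> 2 \<and> m n \<ge> 1 \<and> m_seq x n = int (m n)"
  using eventually_ge_at_top[of 2] m_at_top[unfolded filterlim_at_top, rule_format, of 1]
  by eventually_elim (auto simp: m_def)

lemma eventually_theta:
  "\<forall>\<^sub>F n in sequentially. theta_seq G x n = real n * poisson_tail l (m n)"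
  using eventually_m by eventually_elim (simp add: theta_seq_def x G_nat)

lemma eventually_z:
  "\<forall>\<^sub>F n in sequentially. z_seq G x n = real n * poisson_tail l (m n - 1)"
  using eventually_m
proof eventually_elim
  case (elim n)
  then have "of_int (m_seq x n - 1) = real (m n - 1)" by (simp add: of_nat_diff)
  with elim show ?case by (simp only: z_seq_def x G_nat) simp
qed

text \<open>Rounding gives \<open>m_seq x n - 1 \<le> x n - 1 / 2\<close>, so \<open>z_seq\<close>
  is at least the inverse of a half-step ratio.\<close>

lemma z_at_top: "filterlim (z_seq G x) at_top sequentially"
proof (rule filterlim_at_top_mono)
  have "filterlim (\<lambda>n. x n - 1 / 2) at_top sequentially"
    using filterlim_tendsto_add_at_top[OF tendsto_const x_at_top, of "- (1 / 2)"] by simp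
  from filterlim_compose[OF G_half_step this]
  have "((\<lambda>n. G (x n) / G (x n - 1 / 2)) \<longlonglongrightarrow> 0)" by simp
  then have "filterlim (\<lambda>n. inverse (G (x n) / G (x n - 1 / 2))) at_top sequentially"
    by (rule filterlim_inverse_at_top) (auto intro!: always_eventually divide_pos_pos G_pos)
  then show "filterlim (\<lambda>n. G (x n - 1 / 2) / G (x n)) at_top sequentially" by simp
  show "\<forall>\<^sub>F n in sequentially. G (x n - 1 / 2) / G (x n) \<le> z_seq G x n"
    unfolding z_seq_def m_seq_def
    by (intro always_eventually allI divide_right_mono G_antimono less_imp_le[OF G_pos]) linarith
qed

text \<open>Rounding gives \<open>x n + 1 / 2 \<le> m n + 1\<close>, so one half-step ratio bounds
  the product.\<close>

lemma tail_above_tendsto: "(\<lambda>n. real n * poisson_tail l (m n + 1)) \<longlonglongrightarrow> 0"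
proof (rule tendsto_sandwich[OF _ _ tendsto_const filterlim_compose[OF G_half_step x_at_top]])
  show "\<forall>\<^sub>F n in sequentially. real n * poisson_tail l (m n + 1) \<le> G (x n + 1 / 2) / G (x n)"
    using eventually_m
  proof eventually_elim
    case (elim n)
    then have "x n + 1 / 2 \<le> real (m n + 1)"
      unfolding m_seq_def by linarith
    from G_antimono[OF this] have "real n * poisson_tail l (m n + 1) \<le> real n * G (x n + 1 / 2)"
      by (intro mult_left_mono) (auto simp: G_nat[symmetric])
    then show ?case using elim by (simp add: x mult.commute)
  qed
qed (auto intro!: always_eventually simp: poisson_tail_def)

text \<open>As \<open>z_seq\<close> is eventually at least \<open>1\<close>, \<open>1 / n\<close> is
  at most the Poisson tail at \<open>m n - 1\<close>, against which the square is
  negligible.\<close>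

lemma m_square_over_n_tendsto: "(\<lambda>n. real (m n + 1) ^ 2 / real n) \<longlonglongrightarrow> 0"
proof (rule tendsto_sandwich[OF _ _ tendsto_const])
  have "filterlim (\<lambda>n. m n - 1) at_top sequentially"
    by (rule filterlim_compose[OF filterlim_minus_const_nat_at_top m_at_top])
  from filterlim_compose[OF square_mult_poisson_tail_tendsto[OF l_pos] this]
  show "(\<lambda>n. real (m n - 1 + 2) ^ 2 * poisson_tail l (m n - 1)) \<longlonglongrightarrow> 0" .
  have "\<forall>\<^sub>F n in sequentially. 1 \<le> z_seq G x n"
    using z_at_top by (auto simp: filterlim_at_top)
  then show "\<forall>\<^sub>F n in sequentially. real (m n + 1) ^ 2 / real n \<le>
      real (m n - 1 + 2) ^ 2 * poisson_tail l (m n - 1)"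
    using eventually_m eventually_z
  proof eventually_elim
    case (elim n)
    then have "1 / real n \<le> poisson_tail l (m n - 1)" by (simp add: field_simps)
    then have "real (m n + 1) ^ 2 * (1 / real n) \<le> real (m n + 1) ^ 2 * poisson_tail l (m n - 1)"
      by (intro mult_left_mono) auto
    \<comment> \<open>Natural subtraction: this relies on \<open>m n \<ge> 1\<close>.\<close>
    moreover have "m n - 1 + 2 = m n + 1" using elim by simp
    ultimately show ?case by simp
  qed
qed auto

lemma theta_over_z_tendsto: "(\<lambda>n. theta_seq G x n / z_seq G x n) \<longlonglongrightarrow> 0"
proof -
  have "filterlim (\<lambda>n. m n - 1) at_top sequentially"
    by (rule filterlim_compose[OF filterlim_minus_const_nat_at_top m_at_top])
  from filterlim_compose[OF poisson_tail_ratio_tendsto[OF l_pos] this]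
  show ?thesis
  proof (rule Lim_transform_eventually)
    show "\<forall>\<^sub>F n in sequentially. poisson_tail l (Suc (m n - 1)) / poisson_tail l (m n - 1) =
        theta_seq G x n / z_seq G x n"
      using eventually_m eventually_z eventually_theta by eventually_elim simp
  qed
qed

text \<open>Ensures that the index \<open>n - \<lfloor>c * z\<rfloor>\<close> is eventually a valid
  rank.\<close>

lemma z_over_n_tendsto: "(\<lambda>n. z_seq G x n / real n) \<longlonglongrightarrow> 0"
proof -
  have "filterlim (\<lambda>n. m n - 1) at_top sequentially"
    by (rule filterlim_compose[OF filterlim_minus_const_nat_at_top m_at_top])
  moreover have "poisson_tail l \<longlonglongrightarrow> 0"
  proof (rule tendsto_sandwich[OF _ _ tendsto_const square_mult_poisson_tail_tendsto[OF l_pos]])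
    have "1 * poisson_tail l j \<le> real (j + 2) ^ 2 * poisson_tail l j" for j
      by (intro mult_right_mono one_le_power) (auto simp: poisson_tail_def)
    then show "\<forall>\<^sub>F j in sequentially. poisson_tail l j \<le> real (j + 2) ^ 2 * poisson_tail l j"
      by (intro always_eventually) simp
  qed (auto simp: poisson_tail_def)
  ultimately have "(\<lambda>n. poisson_tail l (m n - 1)) \<longlonglongrightarrow> 0"
    by (rule filterlim_compose[rotated])
  then show ?thesis
  proof (rule Lim_transform_eventually)
    show "\<forall>\<^sub>F n in sequentially. poisson_tail l (m n - 1) = z_seq G x n / real n"
      using eventually_m eventually_z by eventually_elim simp
  qed
qed

end

section \<open>Order statistics\<close>

text \<open>In a sorted list the entries that are at least \<open>v\<close> form a final segment,
  and position \<open>length xs - s - 1\<close> is the first of the last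
  \<open>s + 1\<close>.\<close>

lemma sorted_nth_ge_iff:
  fixes xs :: "'a::linorder list"
  assumes "sorted xs" "s < length xs"
  shows "v \<le> xs ! (length xs - s - 1) \<longleftrightarrow> s + 1 \<le> length (filter (\<lambda>u. v \<le> u) xs)"
proof -
  let ?n = "length xs" and ?S = "{i. i < length xs \<and> v \<le> xs ! i}"
  have len: "length (filter (\<lambda>u. v \<le> u) xs) = card ?S"
    by (rule length_filter_conv_card)
  show ?thesis
  proof
    assume "v \<le> xs ! (?n - s - 1)"
    then have "{?n - s - 1..<?n} \<subseteq> ?S"
      using sorted_nth_mono[OF assms(1)] by (auto intro: order.trans)
    then have "card {?n - s - 1..<?n} \<le> card ?S" by (intro card_mono) auto
    then show "s + 1 \<le> length (filter (\<lambda>u. v \<le> u) xs)" using assms(2) by (simp add: len)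
  next
    assume *: "s + 1 \<le> length (filter (\<lambda>u. v \<le> u) xs)"
    show "v \<le> xs ! (?n - s - 1)"
    proof (rule ccontr)
      assume no: "\<not> v \<le> xs ! (?n - s - 1)"
      have "?S \<subseteq> {?n - s..<?n}"
      proof
        fix i assume i: "i \<in> ?S"
        have "\<not> i \<le> ?n - s - 1"
        proof
          assume "i \<le> ?n - s - 1"
          then have "xs ! i \<le> xs ! (?n - s - 1)"
            using assms by (intro sorted_nth_mono) auto
          with i no show False by (auto dest: order.trans)
        qed
        with i show "i \<in> {?n - s..<?n}" by auto
      qed
      then have "card ?S \<le> card {?n - s..<?n}" by (intro card_mono) auto
      with * assms(2) show False by (simp add: len)
    qed
  qed
qed

lemma order_stat_ge_iff:
  fixes y :: "nat \<Rightarrow> 'a::linorder"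
  assumes "s < n"
  shows "v \<le> order_stat n y (n - s) \<longleftrightarrow> s + 1 \<le> card {i \<in> {1..n}. v \<le> y i}"
proof -
  let ?xs = "map y [1..<Suc n]"
  have "length (filter (\<lambda>u. v \<le> u) (sort ?xs)) = length (filter (\<lambda>u. v \<le> u) ?xs)"
    by (metis mset_filter mset_sort size_mset)
  also have "\<dots> = length (filter (\<lambda>i. v \<le> y i) [1..<Suc n])"
    by (simp add: filter_map o_def del: upt_Suc)
  also have "\<dots> = card {i \<in> {1..n}. v \<le> y i}"
    by (subst distinct_card[symmetric]) (auto intro!: arg_cong[where f = card])
  finally show ?thesis
    using sorted_nth_ge_iff[of "sort ?xs" s v] assms by (simp add: order_stat_def)
qed

lemma order_stat_cong:
  "(\<And>i. i \<in> {1..n} \<Longrightarrow> y i = y' i) \<Longrightarrow> order_stat n y j = order_stat n y' j"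
proof -
  assume "\<And>i. i \<in> {1..n} \<Longrightarrow> y i = y' i"
  then have "map y [1..<Suc n] = map y' [1..<Suc n]" by (intro map_cong) auto
  then show ?thesis by (simp only: order_stat_def)
qed

text \<open>The deterministic core of part (1). The maximum is \<open>m\<close> or
  \<open>m + 1\<close>. If no entry is \<open>m + 1\<close>, the more than \<open>t\<close> entries
  equal to \<open>m\<close> all tie; otherwise exactly the entries equal to \<open>m + 1\<close>
  tie.\<close>

lemma at_least_ties_iff:
  fixes y :: "nat \<Rightarrow> nat"
  assumes "t < n" and none: "card {i \<in> {1..n}. m + 1 < y i} = 0"
    and many: "t < card {i \<in> {1..n}. y i = m}"
  shows "at_least_ties n y t \<longleftrightarrow>
    card {i \<in> {1..n}. y i = m + 1} = 0 \<or> t < card {i \<in> {1..n}. y i = m + 1}"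
proof -
  have le: "y i \<le> m + 1" if "i \<in> {1..n}" for i
    using none that by (auto simp: not_less)
  have eq: "{i \<in> {1..n}. m + 1 \<le> y i} = {i \<in> {1..n}. y i = m + 1}"
    using le by (auto intro: antisym)
  have emp: "{i \<in> {1..n}. m + 2 \<le> y i} = {}"
    using le by fastforce
  have ge: "card {i \<in> {1..n}. y i = m} \<le> card {i \<in> {1..n}. m \<le> y i}"
    by (intro card_mono) auto
  have top: "m + 1 \<le> order_stat n y (n - s) \<longleftrightarrow> s < card {i \<in> {1..n}. y i = m + 1}"
    "\<not> m + 2 \<le> order_stat n y (n - s)" "s \<le> t \<Longrightarrow> m \<le> order_stat n y (n - s)" if "s < n" for s
    using order_stat_ge_iff[OF that, of "m + 1" y] order_stat_ge_iff[OF that, of "m + 2" y]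
      order_stat_ge_iff[OF that, of m y] ge many
    by (auto simp only: eq emp card.empty)
  \<comment> \<open>Here \<open>u\<close> is the order statistic at \<open>n - t\<close>,
    \<open>v\<close> the maximum and \<open>c\<close> the number of entries \<open>m + 1\<close>;
    both \<open>u\<close> and \<open>v\<close> can only be \<open>m\<close> or
    \<open>m + 1\<close>.\<close>
  have arith: "u = v \<longleftrightarrow> c = 0 \<or> t < c"
    if "m + 1 \<le> u \<longleftrightarrow> t < c" "\<not> m + 2 \<le> u" "m \<le> u"
      and "m + 1 \<le> v \<longleftrightarrow> 0 < c" "\<not> m + 2 \<le> v" "m \<le> v" for u v c :: nat
    using that by presburger
  show ?thesis
    unfolding at_least_ties_def
  proof (rule arith)
    show "m + 1 \<le> order_stat n y n \<longleftrightarrow> 0 < card {i \<in> {1..n}. y i = m + 1}"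
      and "\<not> m + 2 \<le> order_stat n y n" and "m \<le> order_stat n y n"
      using top[of 0, unfolded diff_zero] \<open>t < n\<close> by auto
  qed (use top[of t] \<open>t < n\<close> in simp_all)
qed

section \<open>Multinomial counts near the cutoff\<close>

context uniform_multinomial
begin

text \<open>Each weight of a single cell is at most \<open>exp l\<close> times the Poisson weight,
  because the bound on \<open>equal_cells_prob\<close> carries no factor
  \<open>exp (- l)\<close>.\<close>

lemma prob_cell_greater_le:
  assumes l: "l > 0" "real k = l * real n" and i: "i \<in> {1..n}"
  shows "measure M {\<omega> \<in> space M. a < Y i \<omega>} \<le> exp l * poisson_tail l a"
proof (rule sums_le[OF _ measure_greater_sums[OF measurable_Y[OF i]] sums_mult[OF poisson_tail_sums[OF l(1)]]])
  fix b
  have "measure M {\<omega> \<in> space M. Y i \<omega> = a + 1 + b} = equal_cells_prob n k (a + 1 + b) 1"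
    using prob_equal_cells[of "{i}" "a + 1 + b"] i by simp
  also have "\<dots> \<le> ((real k / real n) ^ (a + 1 + b) / fact (a + 1 + b)) ^ 1"
    using n_pos by (intro equal_cells_prob_le) auto
  also have "\<dots> = exp l * (l ^ (a + 1 + b) / fact (a + 1 + b) * exp (- l))"
    using l n_pos by (simp add: exp_minus)
  finally show "measure M {\<omega> \<in> space M. Y i \<omega> = a + 1 + b} \<le>
      exp l * (l ^ (a + 1 + b) / fact (a + 1 + b) * exp (- l))" .
qed

text \<open>Markov's inequality for the count. The threshold \<open>c\<close> is real so that it can
  later be \<open>1\<close> or a multiple of \<open>z_seq\<close>.\<close>

lemma prob_card_greater_le:
  assumes l: "l > 0" "real k = l * real n" and c: "c > 0"
  shows "measure M {\<omega> \<in> space M. c \<le> real (card {i \<in> {1..n}. a < Y i \<omega>})} \<le>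
    real n * (exp l * poisson_tail l a) / c"
proof -
  have meas: "{\<omega> \<in> space M. a < Y i \<omega>} \<in> sets M" if "i \<in> {1..n}" for i
    using measurable_Y[OF that] by measurable
  have "measure M {\<omega> \<in> space M. c \<le> real (card {i \<in> {1..n}. a < Y i \<omega>})} \<le>
      (\<integral>\<omega>. real (card {i \<in> {1..n}. a < Y i \<omega>}) \<partial>M) / c"
    using bounded_count_integrable[OF bounded_count_card[of "\<lambda>v. a < v"], of real] c
    by (intro integral_Markov_inequality_measure[where A = "{}"]) auto
  also have "(\<integral>\<omega>. real (card {i \<in> {1..n}. a < Y i \<omega>}) \<partial>M) =
      (\<integral>\<omega>. (\<Sum>i\<in>{1..n}. indicator {\<omega> \<in> space M. a < Y i \<omega>} \<omega>) \<partial>M)"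
  proof (rule Bochner_Integration.integral_cong)
    fix \<omega> assume "\<omega> \<in> space M"
    then show "real (card {i \<in> {1..n}. a < Y i \<omega>}) =
        (\<Sum>i\<in>{1..n}. indicator {\<omega> \<in> space M. a < Y i \<omega>} \<omega>)"
      by (simp add: indicator_def sum.If_cases Int_def)
  qed simp
  also have "\<dots> = (\<Sum>i\<in>{1..n}. measure M {\<omega> \<in> space M. a < Y i \<omega>})"
    using meas by (subst Bochner_Integration.integral_sum) (auto simp: emeasure_eq_measure)
  also have "\<dots> \<le> (\<Sum>i\<in>{1..n}. exp l * poisson_tail l a)"
    by (intro sum_mono prob_cell_greater_le l)
  also have "\<dots> = real n * (exp l * poisson_tail l a)" by simp
  finally show ?thesis using c by (simp add: divide_right_mono)
qed

end

section \<open>Limits along the admissible \<open>n\<close>\<close>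

locale multinomial_cutoff = poisson_cutoff +
  fixes M :: "nat \<Rightarrow> 'a measure" and Y :: "nat \<Rightarrow> nat \<Rightarrow> 'a \<Rightarrow> nat"
  assumes mult: "\<And>n k :: nat. n > 0 \<Longrightarrow> real k = l * real n \<Longrightarrow>
    multinomial (M n) {1..n} k (\<lambda>_. 1 / real n) (Y n)"
begin

abbreviation F :: "nat filter" where "F \<equiv> admissible_at_top l"

text \<open>A total choice of the number of balls; it equals \<open>l * real n\<close> at the
  admissible \<open>n\<close>, and \<open>F\<close> sees only these.\<close>

definition k :: "nat \<Rightarrow> nat" where "k n = nat \<lfloor>l * real n\<rfloor>"

definition hits :: "nat \<Rightarrow> nat \<Rightarrow> 'a \<Rightarrow> nat"
  where "hits n a = (\<lambda>\<omega>. card {i \<in> {1..n}. Y n i \<omega> = a})"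

definition above :: "nat \<Rightarrow> nat \<Rightarrow> 'a \<Rightarrow> nat"
  where "above n a = (\<lambda>\<omega>. card {i \<in> {1..n}. a < Y n i \<omega>})"

lemma F_le: "F \<le> sequentially"
  by (simp add: admissible_at_top_def)

lemma eventually_k: "\<forall>\<^sub>F n in F. n > 0 \<and> real (k n) = l * real n"
  unfolding admissible_at_top_def eventually_inf_principal
  by (intro always_eventually) (auto simp: k_def Nats_def)

lemma eventually_uniform_multinomial: "\<forall>\<^sub>F n in F. uniform_multinomial (M n) n (k n) (Y n)"
  using eventually_k by eventually_elim (intro uniform_multinomial.intro mult, auto)

lemma eventually_bounded_count: "\<forall>\<^sub>F n in F. bounded_count (M n) (hits n (a n))"
  using eventually_uniform_multinomial unfolding hits_def
  by eventually_elim (rule uniform_multinomial.bounded_count_card)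

text \<open>The Poisson mean may be replaced by any asymptotically equal sequence
  \<open>\<theta>\<close>, at the cost of the factor \<open>(?\<mu> n / \<theta> n) ^ r\<close>,
  which tends to \<open>1\<close>.\<close>

lemma hits_moment_tendsto:
  assumes a: "(\<lambda>n. real (a n) ^ 2 / real n) \<longlonglongrightarrow> 0"
    and \<theta>: "(\<lambda>n. real n * (l ^ a n / fact (a n) * exp (- l)) / \<theta> n) \<longlonglongrightarrow> 1"
  shows "((\<lambda>n. fact r * binomial_moment (M n) (hits n (a n)) r / \<theta> n ^ r) \<longlongrightarrow> 1) F"
proof -
  let ?\<mu> = "\<lambda>n. real n * (l ^ a n / fact (a n) * exp (- l))"
  have "((\<lambda>n. fact r * (real (n choose r) * equal_cells_prob n (k n) (a n) r) / ?\<mu> n ^ r) \<longlongrightarrow> 1) F"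
    using eventually_k
    by (intro choose_mult_equal_cells_prob_asymptotic F_le l_pos tendsto_mono[OF F_le a])
       (auto elim: eventually_mono)
  from tendsto_mult[OF this tendsto_power[OF tendsto_mono[OF F_le \<theta>], of r]]
  have "((\<lambda>n. fact r * (real (n choose r) * equal_cells_prob n (k n) (a n) r) / ?\<mu> n ^ r *
      (?\<mu> n / \<theta> n) ^ r) \<longlongrightarrow> 1) F" by simp
  then show ?thesis
  proof (rule Lim_transform_eventually)
    show "\<forall>\<^sub>F n in F. fact r * (real (n choose r) * equal_cells_prob n (k n) (a n) r) / ?\<mu> n ^ r *
        (?\<mu> n / \<theta> n) ^ r = fact r * binomial_moment (M n) (hits n (a n)) r / \<theta> n ^ r"
      using eventually_uniform_multinomial eventually_k
    proof eventually_elim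
      case (elim n)
      interpret uniform_multinomial "M n" n "k n" "Y n" by fact
      have "?\<mu> n \<noteq> 0" using elim l_pos by simp
      moreover have "binomial_moment (M n) (hits n (a n)) r =
          real (n choose r) * equal_cells_prob n (k n) (a n) r"
        unfolding hits_def by (rule binomial_moment_card_eq)
      ultimately show ?case by (simp only: power_divide) simp
    qed
  qed
qed

text \<open>In the constant, \<open>2\<close> comes from the ratio of the means being eventually
  below \<open>2\<close>, and \<open>exp l\<close> from the factor \<open>exp (- l)\<close> missing
  in the bound on \<open>equal_cells_prob\<close>.\<close>

lemma hits_moment_le:
  assumes \<theta>: "(\<lambda>n. real n * (l ^ a n / fact (a n) * exp (- l)) / \<theta> n) \<longlonglongrightarrow> 1"
    and pos: "\<forall>\<^sub>F n in F. \<theta> n > 0"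
  shows "\<forall>\<^sub>F n in F. \<forall>r. binomial_moment (M n) (hits n (a n)) r \<le> (2 * exp l * \<theta> n) ^ r / fact r"
proof -
  have "\<forall>\<^sub>F n in F. real n * (l ^ a n / fact (a n) * exp (- l)) / \<theta> n < 2"
    by (rule order_tendstoD(2)[OF tendsto_mono[OF F_le \<theta>]]) simp
  then show ?thesis
    using eventually_uniform_multinomial eventually_k pos
  proof eventually_elim
    case (elim n)
    interpret uniform_multinomial "M n" n "k n" "Y n" by fact
    have ratio: "real (k n) / real n = l" using elim by simp
    have "real n * (l ^ a n / fact (a n)) \<le> 2 * exp l * \<theta> n"
      using elim by (simp add: exp_minus field_simps)
    then have "(real n * (l ^ a n / fact (a n))) ^ r / fact r \<le> (2 * exp l * \<theta> n) ^ r / fact r" for r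
      using l_pos by (intro divide_right_mono power_mono) auto
    with choose_mult_equal_cells_prob_le[OF n_pos, of _ "k n" "a n"] show ?case
      unfolding hits_def binomial_moment_card_eq ratio by (blast intro: order.trans)
  qed
qed

text \<open>The weight at \<open>m n + 1\<close> is the leading term of the tail at
  \<open>m n\<close>, which defines \<open>theta_seq\<close>.\<close>

lemma hits_above_cutoff_ratio:
  "(\<lambda>n. real n * (l ^ (m n + 1) / fact (m n + 1) * exp (- l)) / theta_seq G x n) \<longlonglongrightarrow> 1"
  using filterlim_compose[OF poisson_pmf_tail_asymptotic[OF l_pos] m_at_top]
proof (rule Lim_transform_eventually)
  show "\<forall>\<^sub>F n in sequentially. l ^ Suc (m n) / fact (Suc (m n)) * exp (- l) / poisson_tail l (m n) =
      real n * (l ^ (m n + 1) / fact (m n + 1) * exp (- l)) / theta_seq G x n"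
    using eventually_m eventually_theta
    by eventually_elim (simp only: Suc_eq_plus1, simp)
qed

lemma hits_cutoff_ratio:
  "(\<lambda>n. real n * (l ^ m n / fact (m n) * exp (- l)) / z_seq G x n) \<longlonglongrightarrow> 1"
proof -
  have "filterlim (\<lambda>n. m n - 1) at_top sequentially"
    by (rule filterlim_compose[OF filterlim_minus_const_nat_at_top m_at_top])
  from filterlim_compose[OF poisson_pmf_tail_asymptotic[OF l_pos] this]
  show ?thesis
  proof (rule Lim_transform_eventually)
    show "\<forall>\<^sub>F n in sequentially. l ^ Suc (m n - 1) / fact (Suc (m n - 1)) * exp (- l) /
        poisson_tail l (m n - 1) = real n * (l ^ m n / fact (m n) * exp (- l)) / z_seq G x n"
      using eventually_m eventually_z
    proof eventually_elim
      case (elim n)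
      then have "Suc (m n - 1) = m n" by simp
      with elim show ?case by simp
    qed
  qed
qed

lemma theta_pos: "theta_seq G x n > 0"
  unfolding theta_seq_def by (intro divide_pos_pos G_pos)

lemma hits_above_cutoff_poisson:
  "((\<lambda>n. measure (M n) {\<omega> \<in> space (M n). hits n (m n + 1) \<omega> = j} -
     exp (- theta_seq G x n) * theta_seq G x n ^ j / fact j) \<longlongrightarrow> 0) F"
  using eventually_bounded_count
proof (rule poisson_limit)
  show "((\<lambda>n. fact r * binomial_moment (M n) (hits n (m n + 1)) r / theta_seq G x n ^ r) \<longlongrightarrow> 1) F" for r
    using m_square_over_n_tendsto hits_above_cutoff_ratio by (rule hits_moment_tendsto)
  show "\<forall>\<^sub>F n in F. \<forall>r. binomial_moment (M n) (hits n (m n + 1)) r \<le>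
      (2 * exp l * theta_seq G x n) ^ r / fact r"
    using hits_above_cutoff_ratio by (rule hits_moment_le) (simp add: theta_pos)
qed (simp add: theta_pos)

lemma hits_cutoff_concentrated:
  assumes "\<epsilon> > 0"
  shows "((\<lambda>n. measure (M n) {\<omega> \<in> space (M n).
    \<bar>real (hits n (m n) \<omega>) - z_seq G x n\<bar> \<ge> \<epsilon> * z_seq G x n}) \<longlongrightarrow> 0) F"
proof (rule deviation_prob_tendsto_0[OF eventually_bounded_count _ _ _ assms])
  have "(\<lambda>n. real (m n) ^ 2 / real n) \<longlonglongrightarrow> 0"
    by (rule tendsto_sandwich[OF _ _ tendsto_const m_square_over_n_tendsto])
       (auto intro!: always_eventually divide_right_mono power_mono)
  note lim = hits_moment_tendsto[OF this hits_cutoff_ratio]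
  show "((\<lambda>n. binomial_moment (M n) (hits n (m n)) 1 / z_seq G x n) \<longlongrightarrow> 1) F"
    using lim[of 1] by simp
  show "((\<lambda>n. 2 * binomial_moment (M n) (hits n (m n)) 2 / z_seq G x n ^ 2) \<longlongrightarrow> 1) F"
    using lim[of 2] by simp
  show "filterlim (z_seq G x) at_top F"
    by (rule filterlim_mono[OF z_at_top order_refl F_le])
qed

lemma above_tendsto:
  assumes lim: "((\<lambda>n. real n * poisson_tail l (a n) / c n) \<longlongrightarrow> 0) F"
    and c: "\<forall>\<^sub>F n in F. c n > 0"
  shows "((\<lambda>n. measure (M n) {\<omega> \<in> space (M n). c n \<le> real (above n (a n) \<omega>)}) \<longlongrightarrow> 0) F"
proof (rule tendsto_sandwich[OF _ _ tendsto_const])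
  show "((\<lambda>n. exp l * (real n * poisson_tail l (a n) / c n)) \<longlongrightarrow> 0) F"
    using tendsto_mult[OF tendsto_const lim, of "exp l"] by simp
  show "\<forall>\<^sub>F n in F. measure (M n) {\<omega> \<in> space (M n). c n \<le> real (above n (a n) \<omega>)} \<le>
      exp l * (real n * poisson_tail l (a n) / c n)"
    using eventually_uniform_multinomial eventually_k c
  proof eventually_elim
    case (elim n)
    interpret uniform_multinomial "M n" n "k n" "Y n" by fact
    show ?case
      using prob_card_greater_le[OF l_pos, of "c n" "a n"] elim
      by (simp add: above_def mult_ac)
  qed
qed auto

text \<open>The quantifier over \<open>f\<close> stands inside the eventuality so that the event may
  depend on \<open>n\<close>.\<close>

lemma eventually_events_measurable:
  "\<forall>\<^sub>F n in F. \<forall>f. (\<forall>y y'. (\<forall>i\<in>{1..n}. y i = y' i) \<longrightarrow> f y = f y') \<longrightarrow>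
    {\<omega> \<in> space (M n). f (\<lambda>i. Y n i \<omega>)} \<in> sets (M n)"
  using eventually_uniform_multinomial
proof eventually_elim
  case (elim n)
  interpret uniform_multinomial "M n" n "k n" "Y n" by fact
  show ?case
  proof (intro allI impI)
    fix f :: "(nat \<Rightarrow> nat) \<Rightarrow> bool"
    assume "\<forall>y y'. (\<forall>i\<in>{1..n}. y i = y' i) \<longrightarrow> f y = f y'"
    then have "(\<lambda>\<omega>. f (\<lambda>i. Y n i \<omega>)) \<in> measurable (M n) (count_space UNIV)"
      by (intro measurable_fun_Y[of f]) blast
    then show "{\<omega> \<in> space (M n). f (\<lambda>i. Y n i \<omega>)} \<in> sets (M n)" by measurable
  qed
qed

lemma hits_event_measurable:
  "\<forall>\<^sub>F n in F. {\<omega> \<in> space (M n). P n (hits n (a n) \<omega>)} \<in> sets (M n)"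
  using eventually_bounded_count[of a]
proof eventually_elim
  case (elim n)
  note [measurable] = bounded_count_measurable[OF elim]
  show ?case by measurable
qed

lemma above_event_measurable:
  "\<forall>\<^sub>F n in F. {\<omega> \<in> space (M n). P n (above n (a n) \<omega>)} \<in> sets (M n)"
  using eventually_uniform_multinomial
proof eventually_elim
  case (elim n)
  interpret uniform_multinomial "M n" n "k n" "Y n" by fact
  have [measurable]: "above n (a n) \<in> measurable (M n) (count_space UNIV)"
    unfolding above_def by (rule bounded_count_measurable[OF bounded_count_card])
  show ?case by measurable
qed

text \<open>Two order statistics are allowed, which covers both the tie event and the threshold
  event.\<close>

lemma order_stat_event_measurable:
  "\<forall>\<^sub>F n in F. {\<omega> \<in> space (M n). P n (order_stat n (\<lambda>i. Y n i \<omega>) (s n)) (order_stat n (\<lambda>i. Y n i \<omega>) (s' n))}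
    \<in> sets (M n)"
  using eventually_events_measurable
proof eventually_elim
  case (elim n)
  have "P n (order_stat n y (s n)) (order_stat n y (s' n)) = P n (order_stat n y' (s n)) (order_stat n y' (s' n))"
    if "\<forall>i\<in>{1..n}. y i = y' i" for y y' :: "nat \<Rightarrow> nat"
    using order_stat_cong[of n y y'] that by simp
  with elim[rule_format, of "\<lambda>y. P n (order_stat n y (s n)) (order_stat n y (s' n))"] show ?case
    by blast
qed

text \<open>Once \<open>z_seq\<close> is at least \<open>2 * t\<close>, having at most
  \<open>t\<close> cells at the cutoff is a deviation by half of \<open>z_seq\<close>.\<close>

lemma few_at_cutoff_tendsto:
  "((\<lambda>n. measure (M n) {\<omega> \<in> space (M n). hits n (m n) \<omega> \<le> t}) \<longlongrightarrow> 0) F"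
proof (rule tendsto_sandwich[OF _ _ tendsto_const hits_cutoff_concentrated[of "1/2"]])
  have "filterlim (z_seq G x) at_top F"
    by (rule filterlim_mono[OF z_at_top order_refl F_le])
  then have "\<forall>\<^sub>F n in F. 2 * real t \<le> z_seq G x n" by (auto simp: filterlim_at_top)
  with eventually_uniform_multinomial
    hits_event_measurable[of "\<lambda>n v. \<bar>real v - z_seq G x n\<bar> \<ge> 1/2 * z_seq G x n" m]
  show "\<forall>\<^sub>F n in F. measure (M n) {\<omega> \<in> space (M n). hits n (m n) \<omega> \<le> t} \<le>
      measure (M n) {\<omega> \<in> space (M n). \<bar>real (hits n (m n) \<omega>) - z_seq G x n\<bar> \<ge> 1/2 * z_seq G x n}"
  proof eventually_elim
    case (elim n)
    interpret uniform_multinomial "M n" n "k n" "Y n" by fact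
    show ?case by (rule finite_measure_mono[OF _ elim(2)]) (use elim(3) in auto)
  qed
qed auto

lemma above_cutoff_Suc_tendsto:
  "((\<lambda>n. measure (M n) {\<omega> \<in> space (M n). 0 < above n (m n + 1) \<omega>}) \<longlongrightarrow> 0) F"
proof -
  have "((\<lambda>n. measure (M n) {\<omega> \<in> space (M n). 1 \<le> real (above n (m n + 1) \<omega>)}) \<longlongrightarrow> 0) F"
    by (rule above_tendsto) (use tendsto_mono[OF F_le tail_above_tendsto] in auto)
  moreover have "1 \<le> real j \<longleftrightarrow> 0 < j" for j by auto
  ultimately show ?thesis by simp
qed

text \<open>Outside two exceptional events of vanishing probability, ties are decided by the number
  of cells at \<open>m n + 1\<close>. The complementary event is that this number lies between
  \<open>1\<close> and \<open>t\<close>, a finite sum of nearly Poisson probabilities.\<close>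

lemma ties_prob_tendsto:
  "((\<lambda>n. measure (M n) {\<omega> \<in> space (M n). at_least_ties n (\<lambda>i. Y n i \<omega>) t} -
     (1 - (\<Sum>j=1..t. exp (- theta_seq G x n) * theta_seq G x n ^ j / fact j))) \<longlongrightarrow> 0) F"
proof -
  let ?T = "\<lambda>n. {\<omega> \<in> space (M n). at_least_ties n (\<lambda>i. Y n i \<omega>) t}"
  let ?H = "\<lambda>n. {\<omega> \<in> space (M n). hits n (m n + 1) \<omega> = 0 \<or> t < hits n (m n + 1) \<omega>}"
  let ?A = "\<lambda>n. {\<omega> \<in> space (M n). 0 < above n (m n + 1) \<omega>}"
  let ?B = "\<lambda>n. {\<omega> \<in> space (M n). hits n (m n) \<omega> \<le> t}"
  let ?q = "\<lambda>n j. exp (- theta_seq G x n) * theta_seq G x n ^ j / fact j"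
  let ?h = "\<lambda>n j. measure (M n) {\<omega> \<in> space (M n). hits n (m n + 1) \<omega> = j}"
  have TH: "((\<lambda>n. measure (M n) (?T n) - measure (M n) (?H n)) \<longlongrightarrow> 0) F"
  proof (rule Lim_null_comparison)
    show "((\<lambda>n. measure (M n) (?A n) + measure (M n) (?B n)) \<longlongrightarrow> 0) F"
      using tendsto_add[OF above_cutoff_Suc_tendsto few_at_cutoff_tendsto[of t]] by simp
    have "\<forall>\<^sub>F n in F. t < n" by (rule filter_leD[OF F_le eventually_gt_at_top])
    with eventually_uniform_multinomial
      order_stat_event_measurable[of "\<lambda>_. (=)" "\<lambda>n. n - t" "\<lambda>n. n"]
      hits_event_measurable[of "\<lambda>_ v. v = 0 \<or> t < v" "\<lambda>n. m n + 1"]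
      above_event_measurable[of "\<lambda>_ v. 0 < v" "\<lambda>n. m n + 1"]
      hits_event_measurable[of "\<lambda>_ v. v \<le> t" m]
    show "\<forall>\<^sub>F n in F. norm (measure (M n) (?T n) - measure (M n) (?H n)) \<le>
        measure (M n) (?A n) + measure (M n) (?B n)"
    proof eventually_elim
      case (elim n)
      interpret uniform_multinomial "M n" n "k n" "Y n" by fact
      have T: "?T n \<in> events" using elim(2) unfolding at_least_ties_def .
      note H = elim(3) and A = elim(4) and B = elim(5)
      \<comment> \<open>The symmetric difference of \<open>?T n\<close> and \<open>?H n\<close> is
        contained in \<open>?A n \<union> ?B n\<close>.\<close>
      have iff: "\<omega> \<in> ?T n \<longleftrightarrow> \<omega> \<in> ?H n" if "\<omega> \<in> space (M n)" "\<omega> \<notin> ?A n" "\<omega> \<notin> ?B n" for \<omega>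
      proof -
        have "above n (m n + 1) \<omega> = 0" "t < hits n (m n) \<omega>" using that by auto
        from at_least_ties_iff[OF elim(6) this[unfolded hits_def above_def]] show ?thesis
          using that(1) by (simp add: hits_def)
      qed
      have AB: "prob (?A n \<union> ?B n) \<le> prob (?A n) + prob (?B n)"
        by (intro measure_Un_le A B)
      have "prob (?T n) \<le> prob (?H n \<union> (?A n \<union> ?B n))"
        by (rule finite_measure_mono) (use iff in blast, intro sets.Un H A B)
      also have "\<dots> \<le> prob (?H n) + prob (?A n \<union> ?B n)"
        by (intro measure_Un_le sets.Un H A B)
      finally have 1: "prob (?T n) \<le> prob (?H n) + prob (?A n \<union> ?B n)" .
      have "prob (?H n) \<le> prob (?T n \<union> (?A n \<union> ?B n))"
        by (rule finite_measure_mono) (use iff in blast, intro sets.Un T A B)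
      also have "\<dots> \<le> prob (?T n) + prob (?A n \<union> ?B n)"
        by (intro measure_Un_le sets.Un T A B)
      finally show ?case using 1 AB by simp
    qed
  qed
  have "((\<lambda>n. (\<Sum>j=1..t. - (?h n j - ?q n j))) \<longlongrightarrow> (\<Sum>j=1..t. - 0)) F"
    by (intro tendsto_intros hits_above_cutoff_poisson)
  from tendsto_add[OF TH this]
  have "((\<lambda>n. measure (M n) (?T n) - measure (M n) (?H n) + (\<Sum>j=1..t. - (?h n j - ?q n j))) \<longlongrightarrow> 0) F"
    by simp
  then show ?thesis
  proof (rule Lim_transform_eventually)
    show "\<forall>\<^sub>F n in F. measure (M n) (?T n) - measure (M n) (?H n) + (\<Sum>j=1..t. - (?h n j - ?q n j)) =
        measure (M n) (?T n) - (1 - (\<Sum>j=1..t. ?q n j))"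
      using eventually_uniform_multinomial eventually_bounded_count[of "\<lambda>n. m n + 1"]
    proof eventually_elim
      case (elim n)
      interpret uniform_multinomial "M n" n "k n" "Y n" by fact
      note [measurable] = bounded_count_measurable[OF elim(2)]
      have meas: "{\<omega> \<in> space (M n). hits n (m n + 1) \<omega> = j} \<in> events" for j
        by measurable
      have "prob (\<Union>j\<in>{1..t}. {\<omega> \<in> space (M n). hits n (m n + 1) \<omega> = j}) = (\<Sum>j=1..t. ?h n j)"
        by (intro finite_measure_finite_Union) (use meas in \<open>auto simp: disjoint_family_on_def\<close>)
      also have "(\<Union>j\<in>{1..t}. {\<omega> \<in> space (M n). hits n (m n + 1) \<omega> = j}) = space (M n) - ?H n"
        by auto
      also have "prob (space (M n) - ?H n) = 1 - prob (?H n)"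
        by (rule prob_compl) measurable
      finally show ?case by (simp add: sum_negf sum_subtractf)
    qed
  qed
qed

text \<open>The additive error is divided by the denominator, which stays above a fixed
  \<open>\<delta>\<close> however \<open>theta_seq\<close> behaves.\<close>

lemma ties_prob_asymptotic:
  "((\<lambda>n. measure (M n) {\<omega> \<in> space (M n). at_least_ties n (\<lambda>i. Y n i \<omega>) t} /
        (p_seq G x n + 1 -
          p_seq G x n * (\<Sum>j=0..t. ln (1 / p_seq G x n) ^ j / fact j))) \<longlongrightarrow> 1) F"
proof -
  let ?P = "\<lambda>n. measure (M n) {\<omega> \<in> space (M n). at_least_ties n (\<lambda>i. Y n i \<omega>) t}"
  let ?D = "\<lambda>n. 1 - (\<Sum>j=1..t. exp (- theta_seq G x n) * theta_seq G x n ^ j / fact j)"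
  \<comment> \<open>As \<open>ln (1 / p) = \<theta>\<close>, the term \<open>j = 0\<close> of the
    sum contributes \<open>p\<close> and cancels the leading \<open>p\<close>.\<close>
  have D: "p_seq G x n + 1 - p_seq G x n * (\<Sum>j=0..t. ln (1 / p_seq G x n) ^ j / fact j) = ?D n" for n
  proof -
    have "ln (1 / p_seq G x n) = theta_seq G x n" by (simp add: p_seq_def ln_div)
    then show ?thesis
      by (simp add: p_seq_def sum.atLeast_Suc_atMost[of 0] distrib_left sum_distrib_left)
  qed
  obtain \<delta> where \<delta>: "\<delta> > 0" "\<And>n. \<delta> \<le> ?D n"
    using poisson_gap_bounded_below[of t] less_imp_le[OF theta_pos] by blast
  have "((\<lambda>n. (?P n - ?D n) / ?D n) \<longlongrightarrow> 0) F"
  proof (rule Lim_null_comparison)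
    show "((\<lambda>n. \<bar>?P n - ?D n\<bar> / \<delta>) \<longlongrightarrow> 0) F"
      using tendsto_divide[OF tendsto_rabs[OF ties_prob_tendsto[of t]] tendsto_const, of \<delta>] \<delta>(1) by simp
    have "norm ((?P n - ?D n) / ?D n) \<le> \<bar>?P n - ?D n\<bar> / \<delta>" for n
    proof -
      have "norm ((?P n - ?D n) / ?D n) = \<bar>?P n - ?D n\<bar> / ?D n"
        using less_le_trans[OF \<delta>(1) \<delta>(2)[of n]] by simp
      also have "\<dots> \<le> \<bar>?P n - ?D n\<bar> / \<delta>"
        using less_le_trans[OF \<delta>(1) \<delta>(2)[of n]] by (intro divide_left_mono \<delta> mult_pos_pos) auto
      finally show ?thesis .
    qed
    then show "\<forall>\<^sub>F n in F. norm ((?P n - ?D n) / ?D n) \<le> \<bar>?P n - ?D n\<bar> / \<delta>"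
      by (intro always_eventually) blast
  qed
  from tendsto_add[OF tendsto_const this, of 1] show ?thesis
    unfolding D
  proof (simp only: add_0_right, elim Lim_transform_eventually, intro always_eventually allI)
    fix n
    show "1 + (?P n - ?D n) / ?D n = ?P n / ?D n"
      using less_le_trans[OF \<delta>(1) \<delta>(2)[of n]] by (simp add: diff_divide_distrib)
  qed
qed

text \<open>Since everything is integral, exceeding \<open>m_seq x n - 1\<close> means reaching
  \<open>m n\<close>, and having at least \<open>\<lfloor>c * z\<rfloor> + 1\<close> such cells
  means having more than \<open>c * z\<close>.\<close>

lemma eventually_order_stat_iff:
  assumes "c > 0"
  shows "\<forall>\<^sub>F n in F. z_seq G x n > 0 \<and> (\<forall>\<omega>.
    int (order_stat n (\<lambda>i. Y n i \<omega>) (n - nat \<lfloor>c * z_seq G x n\<rfloor>)) > m_seq x n - 1 \<longleftrightarrow>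
    c * z_seq G x n < real (hits n (m n) \<omega> + above n (m n) \<omega>))"
proof -
  have "(\<lambda>n. c * (z_seq G x n / real n)) \<longlonglongrightarrow> c * 0"
    by (intro tendsto_intros z_over_n_tendsto)
  then have "\<forall>\<^sub>F n in sequentially. c * (z_seq G x n / real n) < 1"
    by (intro order_tendstoD(2)) auto
  moreover have "\<forall>\<^sub>F n in sequentially. z_seq G x n > 0"
    using z_at_top by (auto simp: filterlim_at_top_dense)
  ultimately have "\<forall>\<^sub>F n in sequentially. z_seq G x n > 0 \<and> (\<forall>\<omega>.
    int (order_stat n (\<lambda>i. Y n i \<omega>) (n - nat \<lfloor>c * z_seq G x n\<rfloor>)) > m_seq x n - 1 \<longleftrightarrow>
    c * z_seq G x n < real (hits n (m n) \<omega> + above n (m n) \<omega>))"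
    using eventually_m
  proof eventually_elim
    case (elim n)
    define s where "s = nat \<lfloor>c * z_seq G x n\<rfloor>"
    have cz: "c * z_seq G x n > 0" "c * z_seq G x n < real n"
      using elim assms by (auto simp: field_simps)
    then have s: "s < n" unfolding s_def by linarith
    have "int (order_stat n (\<lambda>i. Y n i \<omega>) (n - s)) > m_seq x n - 1 \<longleftrightarrow>
        c * z_seq G x n < real (hits n (m n) \<omega> + above n (m n) \<omega>)" for \<omega>
    proof -
      have "int (order_stat n (\<lambda>i. Y n i \<omega>) (n - s)) > m_seq x n - 1 \<longleftrightarrow>
          m n \<le> order_stat n (\<lambda>i. Y n i \<omega>) (n - s)"
        using elim by auto
      also have "\<dots> \<longleftrightarrow> s + 1 \<le> card {i \<in> {1..n}. m n \<le> Y n i \<omega>}"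
        by (rule order_stat_ge_iff[OF s])
      also have "{i \<in> {1..n}. m n \<le> Y n i \<omega>} =
          {i \<in> {1..n}. Y n i \<omega> = m n} \<union> {i \<in> {1..n}. m n < Y n i \<omega>}" by auto
      also have "card \<dots> = hits n (m n) \<omega> + above n (m n) \<omega>"
        unfolding hits_def above_def by (intro card_Un_disjoint) auto
      also have "s + 1 \<le> hits n (m n) \<omega> + above n (m n) \<omega> \<longleftrightarrow>
          c * z_seq G x n < real (hits n (m n) \<omega> + above n (m n) \<omega>)"
        unfolding s_def using cz by linarith
      finally show ?thesis .
    qed
    then show ?case using elim by (simp add: s_def)
  qed
  then show ?thesis by (rule filter_leD[OF F_le])
qed

text \<open>By concentration the cells at the cutoff alone already outnumber
  \<open>c * z_seq\<close>; cells above it only help.\<close>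

lemma order_stat_prob_tendsto_1:
  assumes "0 < c" "c < 1"
  shows "((\<lambda>n. measure (M n) {\<omega> \<in> space (M n).
    int (order_stat n (\<lambda>i. Y n i \<omega>) (n - nat \<lfloor>c * z_seq G x n\<rfloor>)) > m_seq x n - 1}) \<longlongrightarrow> 1) F"
    (is "((\<lambda>n. measure (M n) (?E n)) \<longlongrightarrow> 1) F")
proof (rule tendsto_sandwich)
  let ?B = "\<lambda>n. {\<omega> \<in> space (M n). \<bar>real (hits n (m n) \<omega>) - z_seq G x n\<bar> \<ge> (1 - c) * z_seq G x n}"
  show "((\<lambda>n. 1 - measure (M n) (?B n)) \<longlongrightarrow> 1) F"
    using tendsto_diff[OF tendsto_const hits_cutoff_concentrated[of "1 - c"], of 1] assms by simp
  show "\<forall>\<^sub>F n in F. 1 - measure (M n) (?B n) \<le> measure (M n) (?E n)"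
    using eventually_order_stat_iff[OF assms(1)] eventually_uniform_multinomial
      order_stat_event_measurable[of "\<lambda>n v _. int v > m_seq x n - 1" "\<lambda>n. n - nat \<lfloor>c * z_seq G x n\<rfloor>" "\<lambda>n. n"]
      hits_event_measurable[of "\<lambda>n v. \<bar>real v - z_seq G x n\<bar> \<ge> (1 - c) * z_seq G x n" m]
  proof eventually_elim
    case (elim n)
    interpret uniform_multinomial "M n" n "k n" "Y n" by fact
    have "prob (space (M n) - ?B n) \<le> prob (?E n)"
    proof (rule finite_measure_mono)
      show "space (M n) - ?B n \<subseteq> ?E n"
      proof
        fix \<omega> assume \<omega>: "\<omega> \<in> space (M n) - ?B n"
        then have "\<bar>real (hits n (m n) \<omega>) - z_seq G x n\<bar> < (1 - c) * z_seq G x n" by auto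
        then have "c * z_seq G x n < real (hits n (m n) \<omega> + above n (m n) \<omega>)"
          by (simp add: algebra_simps)
        then show "\<omega> \<in> ?E n" using elim(1) \<omega> by simp
      qed
    qed (rule elim(3))
    then show ?case by (simp only: prob_compl[OF elim(4)])
  qed
  show "\<forall>\<^sub>F n in F. measure (M n) (?E n) \<le> 1"
    using eventually_uniform_multinomial
  proof eventually_elim
    case (elim n)
    interpret uniform_multinomial "M n" n "k n" "Y n" by fact
    show ?case by simp
  qed
qed simp

text \<open>The excess over \<open>z_seq\<close> must come from a deviation at the cutoff or from
  many cells above it. Markov's inequality rules out the latter, since \<open>theta_seq\<close> is
  negligible against \<open>z_seq\<close>.\<close>

lemma order_stat_prob_tendsto_0:
  assumes "c > 1"
  shows "((\<lambda>n. measure (M n) {\<omega> \<in> space (M n).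
    int (order_stat n (\<lambda>i. Y n i \<omega>) (n - nat \<lfloor>c * z_seq G x n\<rfloor>)) > m_seq x n - 1}) \<longlongrightarrow> 0) F"
    (is "((\<lambda>n. measure (M n) (?E n)) \<longlongrightarrow> 0) F")
proof (rule tendsto_sandwich[OF _ _ tendsto_const])
  \<comment> \<open>Half of the slack \<open>c - 1\<close> goes to each of the two exceptional
    events.\<close>
  define \<epsilon> where "\<epsilon> = (c - 1) / 2"
  have \<epsilon>: "\<epsilon> > 0" "c = 1 + 2 * \<epsilon>" using assms by (simp_all add: \<epsilon>_def field_simps)
  let ?B = "\<lambda>n. {\<omega> \<in> space (M n). \<bar>real (hits n (m n) \<omega>) - z_seq G x n\<bar> \<ge> \<epsilon> * z_seq G x n}"
  let ?A = "\<lambda>n. {\<omega> \<in> space (M n). \<epsilon> * z_seq G x n \<le> real (above n (m n) \<omega>)}"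
  have zpos: "\<forall>\<^sub>F n in F. z_seq G x n > 0"
    using eventually_order_stat_iff[of 1] by (auto elim: eventually_mono)
  have "((\<lambda>n. measure (M n) (?A n)) \<longlongrightarrow> 0) F"
  proof (rule above_tendsto)
    have "((\<lambda>n. theta_seq G x n / z_seq G x n / \<epsilon>) \<longlongrightarrow> 0 / \<epsilon>) F"
      using \<epsilon> by (intro tendsto_intros tendsto_mono[OF F_le theta_over_z_tendsto]) auto
    then have "((\<lambda>n. theta_seq G x n / z_seq G x n / \<epsilon>) \<longlongrightarrow> 0) F" by simp
    then show "((\<lambda>n. real n * poisson_tail l (m n) / (\<epsilon> * z_seq G x n)) \<longlongrightarrow> 0) F"
    proof (rule Lim_transform_eventually)
      show "\<forall>\<^sub>F n in F. theta_seq G x n / z_seq G x n / \<epsilon> =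
          real n * poisson_tail l (m n) / (\<epsilon> * z_seq G x n)"
        using filter_leD[OF F_le eventually_theta] by eventually_elim (simp add: mult.commute)
    qed
    show "\<forall>\<^sub>F n in F. \<epsilon> * z_seq G x n > 0"
      using zpos by eventually_elim (use \<epsilon> in simp)
  qed
  from tendsto_add[OF hits_cutoff_concentrated[OF \<epsilon>(1)] this]
  show "((\<lambda>n. measure (M n) (?B n) + measure (M n) (?A n)) \<longlongrightarrow> 0) F" by simp
  have "c > 0" using assms by simp
  show "\<forall>\<^sub>F n in F. measure (M n) (?E n) \<le> measure (M n) (?B n) + measure (M n) (?A n)"
    using eventually_order_stat_iff[OF \<open>c > 0\<close>] eventually_uniform_multinomial
      hits_event_measurable[of "\<lambda>n v. \<bar>real v - z_seq G x n\<bar> \<ge> \<epsilon> * z_seq G x n" m]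
      above_event_measurable[of "\<lambda>n v. \<epsilon> * z_seq G x n \<le> real v" m]
  proof eventually_elim
    case (elim n)
    interpret uniform_multinomial "M n" n "k n" "Y n" by fact
    have "?E n \<subseteq> ?B n \<union> ?A n"
    proof
      fix \<omega> assume \<omega>: "\<omega> \<in> ?E n"
      then have "c * z_seq G x n < real (hits n (m n) \<omega>) + real (above n (m n) \<omega>)"
        using elim(1) by simp
      moreover have "c * z_seq G x n = z_seq G x n + \<epsilon> * z_seq G x n + \<epsilon> * z_seq G x n"
        by (simp add: \<epsilon>(2) algebra_simps)
      ultimately show "\<omega> \<in> ?B n \<union> ?A n" using \<omega> by auto
    qed
    then have "prob (?E n) \<le> prob (?B n \<union> ?A n)"
      by (rule finite_measure_mono) (intro sets.Un elim(3,4))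
    also have "\<dots> \<le> prob (?B n) + prob (?A n)"
      by (intro measure_Un_le elim(3,4))
    finally show ?case .
  qed
qed auto

end

theorem theorem1p6:
  fixes l :: real
    and M :: "nat \<Rightarrow> 'a measure"
    and Y :: "nat \<Rightarrow> nat \<Rightarrow> 'a \<Rightarrow> nat"
    and G :: "real \<Rightarrow> real"
    and x :: "nat \<Rightarrow> real"
  assumes "l > 0"
    and "\<And>n k :: nat. n > 0 \<Longrightarrow> real k = l * real n \<Longrightarrow>
           multinomial (M n) {1..n} k (\<lambda>_. 1 / real n) (Y n)"
    and "tail_extension (poisson_cdf l) G"
    and "\<And>n. n \<ge> 2 \<Longrightarrow> G (x n) = 1 / real n"
  shows
    "(\<forall>t::nat.
        ((\<lambda>n. measure (M n) {\<omega> \<in> space (M n). at_least_ties n (\<lambda>i. Y n i \<omega>) t} /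
              (p_seq G x n + 1 -
                p_seq G x n * (\<Sum>j=0..t. ln (1 / p_seq G x n) ^ j / fact j)))
          \<longlongrightarrow> 1) (admissible_at_top l)) \<and>
     (\<forall>c::real. c > 0 \<longrightarrow>
        (c < 1 \<longrightarrow>
          ((\<lambda>n. measure (M n) {\<omega> \<in> space (M n).
                  int (order_stat n (\<lambda>i. Y n i \<omega>) (n - nat \<lfloor>c * z_seq G x n\<rfloor>))
                    > m_seq x n - 1}) \<longlongrightarrow> 1) (admissible_at_top l)) \<and>
        (c > 1 \<longrightarrow>
          ((\<lambda>n. measure (M n) {\<omega> \<in> space (M n).
                  int (order_stat n (\<lambda>i. Y n i \<omega>) (n - nat \<lfloor>c * z_seq G x n\<rfloor>))
                    > m_seq x n - 1}) \<longlongrightarrow> 0) (admissible_at_top l)))"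
proof -
  interpret multinomial_cutoff l G x M Y
    by unfold_locales (fact assms)+
  show ?thesis
    by (intro conjI allI impI ties_prob_asymptotic order_stat_prob_tendsto_1 order_stat_prob_tendsto_0)
qed

end
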